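(* For every integer $n\ge 1$ the element $\psi_{2n+1}=(\psi_{2n+1}^{(d)})_{d\ge 1}\in\mathcal{O}$, whose depth $d$ component is (with the convention $x_0=0$, empty products being $1$) $$\psi^{(d)}_{2n+1}=\frac12\sum_{i=1}^{d}\left(\frac{(x_i-x_{i-1})^{2n}}{\prod_{a=0}^{i-2}(x_a-x_{i-1})\prod_{b=i+1}^{d}(x_b-x_i)}+\frac{x_d^{2n}}{\prod_{a=1}^{i-1}x_a\prod_{b=i}^{d-1}(x_b-x_d)}\right)$$ $$\qquad+\frac12\sum_{i=1}^{d-1}\left(\frac{(x_1-x_d)^{2n}}{x_d\prod_{a=2}^{i}(x_a-x_1)\prod_{b=i+1}^{d-1}(x_b-x_d)}-\frac{x_{d-1}^{2n}}{x_d\prod_{a=1}^{i-1}x_a\prod_{b=i}^{d-2}(x_b-x_{d-1})}\right),$$ is homogeneous of weight $2n+1$ and lies in $\mathfrak{p}\mathfrak{dmr}$, i.e. it satisfies the double shuffle equations modulo products.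
   Context: For $d\ge1$ let $\mathcal{O}_d=\mathbb{Q}[x_1,\dots,x_d,x_1^{-1},\dots,x_d^{-1},((x_i-x_j)^{-1})_{1\le i<j\le d}]$ and $\mathcal{O}=\prod_{d\ge1}\mathcal{O}_d$; write $f=(f^{(d)})_{d\ge1}$. An element $f\in\mathcal{O}$ is homogeneous of weight $w$ if each $f^{(d)}$ is homogeneous of degree $w-d$. Shuffle equations modulo products: for all $p,q\ge1$, $$\sum_{w\in \mathrm{Sh}(p,q)} f^{(p+q)}(x_{w_1},\,x_{w_1}+x_{w_2},\,\dots,\,x_{w_1}+\dots+x_{w_{p+q}})=0,$$ where $\mathrm{Sh}(p,q)$ is the set of rearrangements $w=(w_1,\dots,w_{p+q})$ of $(1,\dots,p+q)$ in which $1,\dots,p$ appear in increasing order and $p+1,\dots,p+q$ appear in increasing order. Stuffle equations modulo products: for sequences $u,v,w$ of distinct variables define $F(u;v*w)$ recursively by $F(u;\emptyset*w)=F(u;w*\emptyset)=f^{(|u|+|w|)}(u,w)$ and, for variables $a,b$, $$F(u;av*bw)=F(ua;v*bw)+F(ub;av*w)+\frac{F(ua;v*w)-F(ub;v*w)}{a-b}.$$ The equations are $F(\emptyset;x_1\cdots x_p*x_{p+1}\cdots x_{p+q})=0$ for all $p,q\ge1$. (For $p=q=1$: $f^{(2)}(x_1,x_2)+f^{(2)}(x_2,x_1)=\frac{f^{(1)}(x_2)-f^{(1)}(x_1)}{x_1-x_2}$.) $\mathfrak{p}\mathfrak{dmr}\subset\mathcal{O}$ is the set of $f\in\mathcal{O}$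 satisfying both the shuffle and the stuffle equations modulo products. *)

theory Defs
  imports
    Complex_Main
    "HOL-Library.Poly_Mapping"
    "HOL-Library.FuncSet"
    "HOL-Computational_Algebra.Fraction_Field"
begin

text \<open>
  \<open>mpoly\<close> is \<open>\<rat>[x\<^sub>0, x\<^sub>1, x\<^sub>2, \<dots>]\<close>: a monomial is its finitely supported exponent vector, and
  products are convolution products. All the rings \<open>\<O>\<^sub>d\<close> are realised as subrings of the one
  field of fractions \<open>ratfun\<close>.
\<close>

type_synonym mpoly = "(nat \<Rightarrow>\<^sub>0 nat) \<Rightarrow>\<^sub>0 rat"
type_synonym ratfun = "mpoly fract"

definition ratconst :: "rat \<Rightarrow> ratfun" where
  "ratconst c = Fract (Poly_Mapping.single 0 c) 1"

text \<open>
  \<open>X i\<close> is \<open>x\<^sub>i\<close>. The convention \<open>x\<^sub>0 = 0\<close> is built in, so the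
  indeterminate of \<open>mpoly\<close> with index 0 is never used.
\<close>

definition X :: "nat \<Rightarrow> ratfun" where
  "X i = (if i = 0 then 0 else Fract (Poly_Mapping.single (Poly_Mapping.single i 1) 1) 1)"

inductive_set ringO :: "nat \<Rightarrow> ratfun set" for d :: nat where
  const: "ratconst c \<in> ringO d"
| var: "1 \<le> i \<Longrightarrow> i \<le> d \<Longrightarrow> X i \<in> ringO d"
| inverse_var: "1 \<le> i \<Longrightarrow> i \<le> d \<Longrightarrow> inverse (X i) \<in> ringO d"
| inverse_diff: "1 \<le> i \<Longrightarrow> i < j \<Longrightarrow> j \<le> d \<Longrightarrow> inverse (X i - X j) \<in> ringO d"
| add: "r \<in> ringO d \<Longrightarrow> s \<in> ringO d \<Longrightarrow> r + s \<in> ringO d"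
| mult: "r \<in> ringO d \<Longrightarrow> s \<in> ringO d \<Longrightarrow> r * s \<in> ringO d"

definition prodO :: "(nat \<Rightarrow> ratfun) set" (\<open>\<O>\<close>) where
  "\<O> = (\<Pi>\<^sub>E d\<in>{1..}. ringO d)"


definition homogeneous_mpoly :: "nat \<Rightarrow> mpoly \<Rightarrow> bool" where
  "homogeneous_mpoly k P \<longleftrightarrow>
     (\<forall>m\<in>Poly_Mapping.keys P. (\<Sum>i\<in>Poly_Mapping.keys m. Poly_Mapping.lookup m i) = k)"

text \<open>The zero function is homogeneous of every degree.\<close>

definition homogeneous_ratfun :: "int \<Rightarrow> ratfun \<Rightarrow> bool" where
  "homogeneous_ratfun k r \<longleftrightarrow>
     (\<exists>P Q a b. homogeneous_mpoly a P \<and> homogeneous_mpoly b Q \<and> Q \<noteq> 0 \<and>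
        r = Fract P Q \<and> k = int a - int b)"

definition homogeneous_of_weight :: "int \<Rightarrow> (nat \<Rightarrow> ratfun) \<Rightarrow> bool" where
  "homogeneous_of_weight w f \<longleftrightarrow>
     f \<in> \<O> \<and> (\<forall>d\<ge>1. homogeneous_ratfun (w - int d) (f d))"


definition eval_mpoly :: "(nat \<Rightarrow> ratfun) \<Rightarrow> mpoly \<Rightarrow> ratfun" where
  "eval_mpoly \<sigma> P =
     (\<Sum>m\<in>Poly_Mapping.keys P. ratconst (Poly_Mapping.lookup P m) *
        (\<Prod>i\<in>Poly_Mapping.keys m. \<sigma> i ^ Poly_Mapping.lookup m i))"

text \<open>
  \<open>subst_ratfun [y\<^sub>1, \<dots>, y\<^sub>d] r\<close> is \<open>r(y\<^sub>1, \<dots>, y\<^sub>d)\<close>. The value does not depend on the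
  representation \<open>P / Q\<close>, as long as the denominator does not vanish at the point. A suitable
  representation exists for \<open>r \<in> \<O>\<^sub>d\<close> whenever the \<open>y\<^sub>i\<close> are nonzero and pairwise distinct, which
  is the case for all substitutions below.
\<close>

definition subst_ratfun :: "ratfun list \<Rightarrow> ratfun \<Rightarrow> ratfun" where
  "subst_ratfun ys r =
     (let \<sigma> = (\<lambda>i. if 1 \<le> i \<and> i \<le> length ys then ys ! (i - 1) else 0)
      in THE z. \<exists>P Q. r = Fract P Q \<and> eval_mpoly \<sigma> Q \<noteq> 0 \<and> z = eval_mpoly \<sigma> P / eval_mpoly \<sigma> Q)"

definition eval_at :: "(nat \<Rightarrow> ratfun) \<Rightarrow> ratfun list \<Rightarrow> ratfun" where
  "eval_at f ys = subst_ratfun ys (f (length ys))"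


definition shuffle_equations :: "(nat \<Rightarrow> ratfun) \<Rightarrow> bool" where
  "shuffle_equations f \<longleftrightarrow>
     (\<forall>p\<ge>1. \<forall>q\<ge>1.
        (\<Sum>w\<in>shuffles [1..<p + 1] [p + 1..<p + q + 1].
           eval_at f (map (\<lambda>k. \<Sum>j<k. X (w ! j)) [1..<p + q + 1])) = 0)"

text \<open>Variables are represented by their indices: \<open>i\<close> stands for \<open>x\<^sub>i\<close>.\<close>

fun stuffle_sum :: "(nat \<Rightarrow> ratfun) \<Rightarrow> nat list \<Rightarrow> nat list \<Rightarrow> nat list \<Rightarrow> ratfun" where
  "stuffle_sum f u [] w = eval_at f (map X (u @ w))"
| "stuffle_sum f u w [] = eval_at f (map X (u @ w))"
| "stuffle_sum f u (a # v) (b # w) =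
     stuffle_sum f (u @ [a]) v (b # w) + stuffle_sum f (u @ [b]) (a # v) w +
     (stuffle_sum f (u @ [a]) v w - stuffle_sum f (u @ [b]) v w) / (X a - X b)"

definition stuffle_equations :: "(nat \<Rightarrow> ratfun) \<Rightarrow> bool" where
  "stuffle_equations f \<longleftrightarrow>
     (\<forall>p\<ge>1. \<forall>q\<ge>1. stuffle_sum f [] [1..<p + 1] [p + 1..<p + q + 1] = 0)"

definition pdmr :: "(nat \<Rightarrow> ratfun) set" where
  "pdmr = {f \<in> \<O>. shuffle_equations f \<and> stuffle_equations f}"


text \<open>
  \<open>psi n\<close> is \<open>\<psi>\<^sub>2\<^sub>n\<^sub>+\<^sub>1\<close>. Upper bounds of the form \<open>i - 2\<close>, which may be \<open>-1\<close>, are written as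
  half-open intervals because subtraction on \<open>nat\<close> truncates.
\<close>

definition psi_component :: "nat \<Rightarrow> nat \<Rightarrow> ratfun" where
  "psi_component n d =
     1 / 2 * (\<Sum>i = 1..d.
        (X i - X (i - 1)) ^ (2 * n) /
          ((\<Prod>a\<in>{0..<i - 1}. X a - X (i - 1)) * (\<Prod>b\<in>{i + 1..d}. X b - X i)) +
        X d ^ (2 * n) /
          ((\<Prod>a\<in>{1..<i}. X a) * (\<Prod>b\<in>{i..<d}. X b - X d))) +
     1 / 2 * (\<Sum>i\<in>{1..<d}.
        (X 1 - X d) ^ (2 * n) /
          (X d * (\<Prod>a\<in>{2..i}. X a - X 1) * (\<Prod>b\<in>{i + 1..<d}. X b - X d)) -
        X (d - 1) ^ (2 * n) /
          (X d * (\<Prod>a\<in>{1..<i}. X a) * (\<Prod>b\<in>{i..<d - 1}. X b - X (d - 1))))"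

definition psi :: "nat \<Rightarrow> nat \<Rightarrow> ratfun" where
  "psi n = (\<lambda>d\<in>{1..}. psi_component n d)"

end

theory Submission
  imports Defs
begin

text \<open>
  A family \<open>f\<close> is read as a linear functional on words. Both families of equations say that \<open>f\<close>
  vanishes on the products \<open>v * w\<close> of a quasi-shuffle algebra in which two letters merge
  to \<open>c a b (a - b)\<close>: \<open>c a b = 1 / (a - b)\<close> for the stuffle and \<open>c = 0\<close> for the shuffle product
  (the latter after passing to partial sums). Such functionals, the infinitesimal characters, are
  closed under commutators and under conjugation by characters for the convolution product, and
  \<open>\<psi>\<close> is built from them.

  Write \<open>g t = t\<^sup>2\<^sup>n\<close>. For the stuffle product let \<open>\<chi>\<^sub>a\<close> be the character \<open>w \<mapsto> \<Prod> 1 / (w\<^sub>i - a)\<close>; then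
  \<open>M'\<^sub>a = [first letter a] \<chi>\<^sub>a\<close> and \<open>M\<^sub>a = \<chi>\<^sub>a [last letter a]\<close> are infinitesimal and
  \<open>2 \<psi> = \<Sum>\<^sub>a g(a) (M'\<^sub>a + \<chi>\<^sub>0 M\<^sub>a \<chi>\<^sub>0\<^sup>-\<^sup>1) + \<Sum>\<^sub>a\<^sub>b g(a - b) / b [M'\<^sub>a, M\<^sub>b]\<close>.
  For the shuffle product let \<open>E\<close> be the character \<open>y \<mapsto> \<Prod>\<^sub>k 1 / (y\<^sub>1 + \<dots> + y\<^sub>k)\<close>, whose inverse is
  given by the suffix sums up to sign, let \<open>Z = E 1\<^sub>1 E\<^sup>-\<^sup>1\<close> with \<open>1\<^sub>1\<close> the indicator of words of
  length one, and let \<open>T = y\<^sub>1 + \<dots> + y\<^sub>d\<close>, which is constant on each product; then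
  \<open>2 \<psi> = E\<^sup>-\<^sup>1 G E + g(T) Z + 1 / T [H, Z]\<close>, where \<open>G\<close> and \<open>H\<close> are supported on single letters
  with values \<open>g(a)\<close> and \<open>g(T - a)\<close>.
\<close>

subsection \<open>Convolution and quasi-shuffle products\<close>

text \<open>The product dual to cutting a word in two (deconcatenation); cuts at both ends of the
  word are included.\<close>

definition conv :: "('a list \<Rightarrow> 'b::field) \<Rightarrow> ('a list \<Rightarrow> 'b) \<Rightarrow> 'a list \<Rightarrow> 'b" where
  "conv \<phi> \<psi> w = (\<Sum>k\<le>length w. \<phi> (take k w) * \<psi> (drop k w))"

definition counit :: "'a list \<Rightarrow> 'b::field" where
  "counit w = (if w = [] then 1 else 0)"

lemma conv_Nil [simp]: "conv \<phi> \<psi> [] = \<phi> [] * \<psi> []"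
  by (simp add: conv_def)

lemma conv_Cons: "conv \<phi> \<psi> (a # w) = \<phi> [] * \<psi> (a # w) + conv (\<lambda>u. \<phi> (a # u)) \<psi> w"
  by (simp add: conv_def sum.atMost_Suc_shift del: sum.atMost_Suc)

lemma counit_simps [simp]: "counit [] = 1" "counit (a # w) = 0"
  by (simp_all add: counit_def)

lemma conv_counit_left: "conv counit \<psi> = \<psi>"
proof
  fix w show "conv counit \<psi> w = \<psi> w"
    by (cases w) (simp_all add: conv_Cons, simp add: conv_def)
qed

lemma conv_counit_right: "conv \<phi> counit = \<phi>"
proof
  fix w show "conv \<phi> counit w = \<phi> w"
    by (induction w arbitrary: \<phi>) (simp_all add: conv_Cons)
qed

text \<open>This is the value of the linear functional \<open>\<phi>\<close> on the quasi-shuffle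
  product of two words. The product itself is never formed: a letter put in front of it is absorbed
  into the functional, so no free module of words has to be built.\<close>

fun qsh :: "('a \<Rightarrow> 'a \<Rightarrow> 'b) \<Rightarrow> ('a list \<Rightarrow> 'b::field) \<Rightarrow> 'a list \<Rightarrow> 'a list \<Rightarrow> 'b" where
  "qsh c \<phi> [] w = \<phi> w"
| "qsh c \<phi> v [] = \<phi> v"
| "qsh c \<phi> (a # v) (b # w) =
     qsh c (\<lambda>u. \<phi> (a # u)) v (b # w) + qsh c (\<lambda>u. \<phi> (b # u)) (a # v) w +
     c a b * (qsh c (\<lambda>u. \<phi> (a # u)) v w - qsh c (\<lambda>u. \<phi> (b # u)) v w)"

lemma qsh_Nil_right [simp]: "qsh c \<phi> v [] = \<phi> v"
  by (cases v) simp_all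

lemma qsh_add: "qsh c (\<lambda>u. \<phi> u + \<psi> u) v w = qsh c \<phi> v w + qsh c \<psi> v w"
proof (induction c \<phi> v w arbitrary: \<psi> rule: qsh.induct)
  case (3 c \<phi> a v b w)
  show ?case by (simp only: qsh.simps 3) (simp add: ring_distribs)
qed simp_all

lemma qsh_scale: "qsh c (\<lambda>u. k * \<phi> u) v w = k * qsh c \<phi> v w"
proof (induction c \<phi> v w rule: qsh.induct)
  case (3 c \<phi> a v b w)
  show ?case by (simp only: qsh.simps 3) (simp add: ring_distribs)
qed simp_all

lemma qsh_zero: "qsh c (\<lambda>u. 0) v w = 0"
  using qsh_scale[of c 0] by simp

lemma qsh_diff: "qsh c (\<lambda>u. \<phi> u - \<psi> u) v w = qsh c \<phi> v w - qsh c \<psi> v w"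
  using qsh_add[of c \<phi> "\<lambda>u. (-1) * \<psi> u" v w] by (simp only: qsh_scale) simp

lemma qsh_sum: "qsh c (\<lambda>u. \<Sum>i\<in>I. \<phi> i u) v w = (\<Sum>i\<in>I. qsh c (\<phi> i) v w)"
  by (induction I rule: infinite_finite_induct) (simp_all add: qsh_add qsh_zero)

text \<open>Convolution of functionals on pairs of words, that is, on the tensor square of the word
  algebra.\<close>

definition conv2 ::
  "('a list \<Rightarrow> 'a list \<Rightarrow> 'b::field) \<Rightarrow> ('a list \<Rightarrow> 'a list \<Rightarrow> 'b) \<Rightarrow> 'a list \<Rightarrow> 'a list \<Rightarrow> 'b" where
  "conv2 \<Phi> \<Psi> v w =
     (\<Sum>i\<le>length v. \<Sum>j\<le>length w. \<Phi> (take i v) (take j w) * \<Psi> (drop i v) (drop j w))"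

lemma conv2_tensor:
  "conv2 (\<lambda>v w. \<phi> v * \<phi>' w) (\<lambda>v w. \<psi> v * \<psi>' w) v w = conv \<phi> \<psi> v * conv \<phi>' \<psi>' w"
  by (simp add: conv2_def conv_def sum_product mult_ac)

lemma conv2_add_left:
  "conv2 (\<lambda>v w. \<Phi> v w + \<Phi>' v w) \<Psi> v w = conv2 \<Phi> \<Psi> v w + conv2 \<Phi>' \<Psi> v w"
  by (simp add: conv2_def sum.distrib algebra_simps)

lemma conv2_add_right:
  "conv2 \<Phi> (\<lambda>v w. \<Psi> v w + \<Psi>' v w) v w = conv2 \<Phi> \<Psi> v w + conv2 \<Phi> \<Psi>' v w"
  by (simp add: conv2_def sum.distrib algebra_simps)

text \<open>Deconcatenation is multiplicative for the quasi-shuffle product. By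
  \<open>conv_Cons\<close> a cut lies either before the first letter or after it, and this fits the
  recursion of \<open>qsh\<close> on first letters.\<close>

lemma qsh_conv: "qsh c (conv \<phi> \<psi>) v w = conv2 (qsh c \<phi>) (qsh c \<psi>) v w"
proof (induction c \<phi> v w rule: qsh.induct)
  case (1 c \<phi> w)
  then show ?case by (simp add: conv2_def conv_def)
next
  case (2 c \<phi> a v)
  then show ?case by (simp add: conv2_def conv_def)
next
  case (3 c \<phi> a v b w)
  show ?case
    by (simp add: conv_Cons qsh_add qsh_scale 3)
      (simp add: conv2_def sum.atMost_Suc_shift sum.distrib sum_distrib_left algebra_simps
        sum_subtractf del: sum.atMost_Suc)
qed

subsection \<open>Characters and infinitesimal characters\<close>

lemma conv_cong:
  assumes "\<And>k. k \<le> length w \<Longrightarrow> \<phi> (take k w) = \<phi>' (take k w)"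
    and "\<And>k. k \<le> length w \<Longrightarrow> \<psi> (drop k w) = \<psi>' (drop k w)"
  shows "conv \<phi> \<psi> w = conv \<phi>' \<psi>' w"
  using assms by (simp add: conv_def)

lemma conv_add_left: "conv (\<lambda>u. \<phi> u + \<phi>' u) \<psi> w = conv \<phi> \<psi> w + conv \<phi>' \<psi> w"
  by (simp add: conv_def sum.distrib ring_distribs)

lemma conv_scale_left: "conv (\<lambda>u. k * \<phi> u) \<psi> w = k * conv \<phi> \<psi> w"
  by (simp add: conv_def sum_distrib_left mult.assoc)

lemma conv_assoc: "conv (conv \<phi> \<psi>) \<chi> = conv \<phi> (conv \<psi> \<chi>)"
proof
  fix w show "conv (conv \<phi> \<psi>) \<chi> w = conv \<phi> (conv \<psi> \<chi>) w"
    by (induction w arbitrary: \<phi>)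
      (simp_all add: conv_Cons conv_add_left conv_scale_left ring_distribs)
qed

text \<open>Only words with distinct letters, all taken from the two factors, occur in such a
  product, so values of the functional elsewhere never enter.\<close>

lemma qsh_cong:
  assumes "distinct (v @ w)"
    and "\<And>u. distinct u \<Longrightarrow> set u \<subseteq> set v \<union> set w \<Longrightarrow> \<phi> u = \<psi> u"
  shows "qsh c \<phi> v w = qsh c \<psi> v w"
  using assms
proof (induction c \<phi> v w arbitrary: \<psi> rule: qsh.induct)
  case (3 c \<phi> a v b w)
  have "qsh c (\<lambda>u. \<phi> (a # u)) v (b # w) = qsh c (\<lambda>u. \<psi> (a # u)) v (b # w)"
    by (rule 3) (use 3(5,6) in \<open>force intro!: 3(6)\<close>)+
  moreover have "qsh c (\<lambda>u. \<phi> (b # u)) (a # v) w = qsh c (\<lambda>u. \<psi> (b # u)) (a # v) w"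
    by (rule 3) (use 3(5,6) in \<open>force intro!: 3(6)\<close>)+
  moreover have "qsh c (\<lambda>u. \<phi> (a # u)) v w = qsh c (\<lambda>u. \<psi> (a # u)) v w"
    by (rule 3) (use 3(5,6) in \<open>force intro!: 3(6)\<close>)+
  moreover have "qsh c (\<lambda>u. \<phi> (b # u)) v w = qsh c (\<lambda>u. \<psi> (b # u)) v w"
    by (rule 3) (use 3(5,6) in \<open>force intro!: 3(6)\<close>)+
  ultimately show ?case by simp
qed auto

lemma qsh_counit: "qsh c counit v w = counit v * counit w"
  by (cases v; cases w) (simp_all add: qsh_zero)

text \<open>The identities below divide by differences or sums of letters. They are therefore stated
  only for words without repetition over a set \<open>V\<close> of admissible letters.\<close>

definition word_in :: "'a set \<Rightarrow> 'a list \<Rightarrow> bool" where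
  "word_in V w \<longleftrightarrow> distinct w \<and> set w \<subseteq> V"

lemma word_in_simps [simp]:
  "word_in V []" "word_in V (a # w) \<longleftrightarrow> a \<in> V \<and> a \<notin> set w \<and> word_in V w"
  by (auto simp: word_in_def)

lemma word_in_append:
  "word_in V (v @ w) \<longleftrightarrow> word_in V v \<and> word_in V w \<and> set v \<inter> set w = {}"
  by (auto simp: word_in_def)

lemma word_in_take: "word_in V w \<Longrightarrow> word_in V (take k w)"
  and word_in_drop: "word_in V w \<Longrightarrow> word_in V (drop k w)"
  by (auto simp: word_in_def dest: in_set_takeD in_set_dropD)

lemma word_in_take2: "word_in V (v @ w) \<Longrightarrow> word_in V (take i v @ take j w)"
  and word_in_drop2: "word_in V (v @ w) \<Longrightarrow> word_in V (drop i v @ drop j w)"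
  by (auto simp: word_in_append word_in_take word_in_drop dest: in_set_takeD in_set_dropD)

definition is_character ::
  "('a \<Rightarrow> 'a \<Rightarrow> 'b) \<Rightarrow> 'a set \<Rightarrow> ('a list \<Rightarrow> 'b::field) \<Rightarrow> bool" where
  "is_character c V \<phi> \<longleftrightarrow> (\<forall>v w. word_in V (v @ w) \<longrightarrow> qsh c \<phi> v w = \<phi> v * \<phi> w)"

definition infinitesimal ::
  "('a \<Rightarrow> 'a \<Rightarrow> 'b) \<Rightarrow> 'a set \<Rightarrow> ('a list \<Rightarrow> 'b::field) \<Rightarrow> bool" where
  "infinitesimal c V \<phi> \<longleftrightarrow>
     (\<forall>v w. word_in V (v @ w) \<longrightarrow> qsh c \<phi> v w = \<phi> v * counit w + counit v * \<phi> w)"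

definition conv_inverse :: "'a set \<Rightarrow> ('a list \<Rightarrow> 'b::field) \<Rightarrow> ('a list \<Rightarrow> 'b) \<Rightarrow> bool" where
  "conv_inverse V \<phi> \<psi> \<longleftrightarrow> (\<forall>w. word_in V w \<longrightarrow> conv \<phi> \<psi> w = counit w)"

lemma infinitesimal_add:
  "infinitesimal c V \<phi> \<Longrightarrow> infinitesimal c V \<psi> \<Longrightarrow> infinitesimal c V (\<lambda>u. \<phi> u + \<psi> u)"
  by (simp add: infinitesimal_def qsh_add ring_distribs)

lemma infinitesimal_scale: "infinitesimal c V \<phi> \<Longrightarrow> infinitesimal c V (\<lambda>u. k * \<phi> u)"
  by (simp add: infinitesimal_def qsh_scale ring_distribs mult_ac)

lemma infinitesimal_sum:
  "(\<And>i. i \<in> I \<Longrightarrow> infinitesimal c V (\<phi> i)) \<Longrightarrow> infinitesimal c V (\<lambda>u. \<Sum>i\<in>I. \<phi> i u)"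
  by (simp add: infinitesimal_def qsh_sum sum.distrib sum_distrib_left sum_distrib_right)

lemma infinitesimal_vanishes:
  assumes "infinitesimal c V \<phi>" "word_in V (v @ w)" "v \<noteq> []" "w \<noteq> []"
  shows "qsh c \<phi> v w = 0"
  using assms by (simp add: infinitesimal_def counit_def)

text \<open>Prefixes and suffixes of an admissible pair form admissible pairs again, so product
  formulas that hold only on admissible pairs may be used inside \<open>conv2\<close>.\<close>

lemma qsh_conv_word_in:
  assumes "\<And>v w. word_in V (v @ w) \<Longrightarrow> qsh c \<phi> v w = \<Phi> v w"
    and "\<And>v w. word_in V (v @ w) \<Longrightarrow> qsh c \<psi> v w = \<Psi> v w"
    and "word_in V (v @ w)"
  shows "qsh c (conv \<phi> \<psi>) v w = conv2 \<Phi> \<Psi> v w"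
  by (simp add: qsh_conv conv2_def assms word_in_take2 word_in_drop2)

text \<open>The only unwanted terms in the expansion of either product are
  \<open>\<phi> v * \<psi> w + \<psi> v * \<phi> w\<close>. They are symmetric in the two
  functionals and cancel in the commutator.\<close>

lemma infinitesimal_commutator:
  assumes "infinitesimal c V \<phi>" "infinitesimal c V \<psi>"
  shows "infinitesimal c V (\<lambda>u. conv \<phi> \<psi> u - conv \<psi> \<phi> u)"
  unfolding infinitesimal_def
proof (intro allI impI)
  fix v w assume vw: "word_in V (v @ w)"
  have *: "qsh c (conv \<phi> \<psi>) v w =
      conv \<phi> \<psi> v * counit w + \<phi> v * \<psi> w + \<psi> v * \<phi> w + counit v * conv \<phi> \<psi> w"
    if "infinitesimal c V \<phi>" "infinitesimal c V \<psi>" for \<phi> \<psi>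
  proof -
    have "qsh c (conv \<phi> \<psi>) v w = conv2 (\<lambda>v w. \<phi> v * counit w + counit v * \<phi> w)
        (\<lambda>v w. \<psi> v * counit w + counit v * \<psi> w) v w"
      by (rule qsh_conv_word_in[where V = V]) (use that vw in \<open>auto simp: infinitesimal_def\<close>)
    then show ?thesis
      by (simp add: conv2_add_left conv2_add_right conv2_tensor conv_counit_left
        conv_counit_right)
  qed
  show "qsh c (\<lambda>u. conv \<phi> \<psi> u - conv \<psi> \<phi> u) v w =
      (conv \<phi> \<psi> v - conv \<psi> \<phi> v) * counit w + counit v * (conv \<phi> \<psi> w - conv \<psi> \<phi> w)"
    unfolding qsh_diff *[OF assms] *[OF assms(2,1)] by (simp add: algebra_simps)
qed

text \<open>Multiplication by \<open>\<phi>\<close> on the left makes \<open>l\<close> a derivation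
  relative to \<open>\<phi>\<close>. Multiplication by \<open>\<psi>\<close> on the right then turns
  each bare factor \<open>\<phi>\<close> into \<open>conv \<phi> \<psi>\<close>, which is the
  counit.\<close>

lemma infinitesimal_conjugate:
  assumes "is_character c V \<phi>" "is_character c V \<psi>" "conv_inverse V \<phi> \<psi>" "infinitesimal c V l"
  shows "infinitesimal c V (conv (conv \<phi> l) \<psi>)"
  unfolding infinitesimal_def
proof (intro allI impI)
  fix v w assume vw: "word_in V (v @ w)"
  have *: "qsh c (conv \<phi> l) v w = conv \<phi> l v * \<phi> w + \<phi> v * conv \<phi> l w"
    if "word_in V (v @ w)" for v w
  proof -
    have "qsh c (conv \<phi> l) v w = conv2 (\<lambda>v w. \<phi> v * \<phi> w) (\<lambda>v w. l v * counit w + counit v * l w) v w"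
      by (rule qsh_conv_word_in[where V = V])
        (use assms that in \<open>auto simp: infinitesimal_def is_character_def\<close>)
    then show ?thesis
      by (simp add: conv2_add_right conv2_tensor conv_counit_right)
  qed
  have "qsh c (conv (conv \<phi> l) \<psi>) v w =
      conv2 (\<lambda>v w. conv \<phi> l v * \<phi> w + \<phi> v * conv \<phi> l w) (\<lambda>v w. \<psi> v * \<psi> w) v w"
    by (rule qsh_conv_word_in[where V = V]) (use assms vw in \<open>auto simp: * is_character_def\<close>)
  also have "\<dots> = conv (conv \<phi> l) \<psi> v * conv \<phi> \<psi> w + conv \<phi> \<psi> v * conv (conv \<phi> l) \<psi> w"
    by (simp add: conv2_add_left conv2_tensor)
  finally show "qsh c (conv (conv \<phi> l) \<psi>) v w =
      conv (conv \<phi> l) \<psi> v * counit w + counit v * conv (conv \<phi> l) \<psi> w"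
    using assms(3) vw by (simp add: conv_inverse_def word_in_append)
qed

text \<open>By associativity \<open>conv \<phi> (conv \<psi> \<phi>)\<close> agrees with
  \<open>\<phi>\<close>. Its cut at 0 contributes \<open>conv \<psi> \<phi> w\<close> itself, and
  all other cuts involve shorter suffixes, where the induction hypothesis applies.\<close>

lemma conv_inverse_commute:
  assumes inv: "conv_inverse V \<phi> \<psi>" and [simp]: "\<phi> [] = 1" "\<psi> [] = 1"
  shows "conv_inverse V \<psi> \<phi>"
proof -
  have "conv \<psi> \<phi> w = counit w" if "word_in V w" for w
    using that
  proof (induction w rule: length_induct)
    case (1 w)
    show ?case
    proof (cases "w = []")
      case False
      then obtain n where n: "length w = Suc n" by (cases w) auto
      have "conv \<phi> (conv \<psi> \<phi>) w = conv counit \<phi> w"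
        unfolding conv_assoc[symmetric] using inv 1(2)
        by (intro conv_cong) (auto simp: conv_inverse_def word_in_take)
      moreover have "conv \<phi> (conv \<psi> \<phi>) w =
          conv \<psi> \<phi> w + (\<Sum>k\<le>n. \<phi> (take (Suc k) w) * counit (drop (Suc k) w))"
        unfolding conv_def[of \<phi>] n sum.atMost_Suc_shift
        using 1 n by (auto simp: word_in_drop intro!: sum.cong)
      moreover have "\<dots> = conv \<psi> \<phi> w + conv \<phi> counit w"
        unfolding conv_def[of \<phi> counit] n sum.atMost_Suc_shift using False by (simp add: counit_def)
      ultimately show ?thesis
        using False by (simp add: conv_counit_left conv_counit_right counit_def)
    qed simp
  qed
  then show ?thesis by (simp add: conv_inverse_def)
qed

text \<open>Consider the defect \<open>qsh c \<phi> v w - \<phi> v * \<phi> w\<close>. Its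
  convolution with \<open>\<psi> v * \<psi> w\<close> vanishes, because both of its parts convolve
  to the counit on pairs.\<close>

lemma is_character_conv_inverse:
  assumes \<psi>: "is_character c V \<psi>" and inv: "conv_inverse V \<phi> \<psi>" and [simp]: "\<psi> [] = 1"
  shows "is_character c V \<phi>"
proof -
  have "qsh c \<phi> v w = \<phi> v * \<phi> w" if "word_in V (v @ w)" for v w
    using that
  proof (induction "length v + length w" arbitrary: v w rule: less_induct)
    case less
    have "conv2 (qsh c \<phi>) (\<lambda>v w. \<psi> v * \<psi> w) v w = qsh c (conv \<phi> \<psi>) v w"
      by (rule sym, rule qsh_conv_word_in[where V = V])
        (use \<psi> less.prems in \<open>auto simp: is_character_def\<close>)
    also have "\<dots> = qsh c counit v w"
      by (rule qsh_cong)
        (use inv less.prems in \<open>auto simp: conv_inverse_def word_in_def dest: subset_trans[of _ _ V]\<close>)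
    also have "\<dots> = conv \<phi> \<psi> v * conv \<phi> \<psi> w"
      using inv less.prems by (simp add: conv_inverse_def word_in_append qsh_counit)
    also have "\<dots> = conv2 (\<lambda>v w. \<phi> v * \<phi> w) (\<lambda>v w. \<psi> v * \<psi> w) v w"
      by (simp add: conv2_tensor)
    finally have *: "conv2 (\<lambda>v w. qsh c \<phi> v w - \<phi> v * \<phi> w) (\<lambda>v w. \<psi> v * \<psi> w) v w = 0"
      by (simp add: conv2_def left_diff_distrib sum_subtractf)
    \<comment> \<open>By induction the defect is zero on all pairs of prefixes except the full pair,
      whose cofactor is \<open>\<psi> [] * \<psi> [] = 1\<close>.\<close>
    have "conv2 (\<lambda>v w. qsh c \<phi> v w - \<phi> v * \<phi> w) (\<lambda>v w. \<psi> v * \<psi> w) v w =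
        (\<Sum>i\<le>length v. \<Sum>j\<le>length w.
          if i = length v \<and> j = length w then qsh c \<phi> v w - \<phi> v * \<phi> w else 0)"
      unfolding conv2_def
    proof (intro sum.cong refl)
      fix i j assume ij: "i \<in> {..length v}" "j \<in> {..length w}"
      show "(qsh c \<phi> (take i v) (take j w) - \<phi> (take i v) * \<phi> (take j w)) *
          (\<psi> (drop i v) * \<psi> (drop j w)) =
          (if i = length v \<and> j = length w then qsh c \<phi> v w - \<phi> v * \<phi> w else 0)"
      proof (cases "i = length v \<and> j = length w")
        case False
        have "qsh c \<phi> (take i v) (take j w) = \<phi> (take i v) * \<phi> (take j w)"
          by (rule less.hyps) (use False ij less.prems in \<open>auto simp: word_in_take2\<close>)
        with False show ?thesis by auto
      qed simp
    qed
    also have "\<dots> = (\<Sum>i\<le>length v. if i = length v then qsh c \<phi> v w - \<phi> v * \<phi> w else 0)"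
      by (intro sum.cong) auto
    also have "\<dots> = qsh c \<phi> v w - \<phi> v * \<phi> w" by simp
    finally show ?case using * by simp
  qed
  then show ?thesis by (simp add: is_character_def)
qed

subsection \<open>Poles and the stuffle product\<close>

text \<open>In the notation of the overview, \<open>recip_prod a\<close> is
  \<open>\<chi>\<^sub>a\<close>, \<open>first_pole a\<close> is \<open>M'\<^sub>a\<close> and
  \<open>last_pole a\<close> is \<open>M\<^sub>a\<close>.\<close>

definition recip_prod :: "'a::field \<Rightarrow> 'a list \<Rightarrow> 'a" where
  "recip_prod a w = (\<Prod>x\<leftarrow>w. inverse (x - a))"

definition first_pole :: "'a::field \<Rightarrow> 'a list \<Rightarrow> 'a" where
  "first_pole a w = (if w \<noteq> [] \<and> hd w = a then recip_prod a (tl w) else 0)"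

definition last_pole :: "'a::field \<Rightarrow> 'a list \<Rightarrow> 'a" where
  "last_pole a w = (if w \<noteq> [] \<and> last w = a then recip_prod a (butlast w) else 0)"

text \<open>The convolution inverse of \<open>recip_prod 0\<close>. Support in length at most one
  suffices, since \<open>recip_prod 0\<close> gains exactly the factor \<open>inverse x\<close> when
  a letter \<open>x\<close> is appended.\<close>

fun pole_zero :: "'a::field list \<Rightarrow> 'a" where
  "pole_zero [] = 1"
| "pole_zero [x] = - inverse x"
| "pole_zero (x # y # w) = 0"

abbreviation stuffle_coeff :: "'a::field \<Rightarrow> 'a \<Rightarrow> 'a" where
  "stuffle_coeff a b \<equiv> inverse (a - b)"

lemma recip_prod_simps [simp]:
  "recip_prod a [] = 1" "recip_prod a (x # w) = inverse (x - a) * recip_prod a w"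
  by (simp_all add: recip_prod_def)

lemma first_pole_simps [simp]:
  "first_pole a [] = 0" "first_pole a (x # w) = (if x = a then recip_prod a w else 0)"
  by (simp_all add: first_pole_def)

lemma last_pole_Nil [simp]: "last_pole a [] = 0"
  by (simp add: last_pole_def)

text \<open>A recursion on the first letter is needed because \<open>qsh\<close> consumes words from
  the front. If \<open>x = a\<close> and \<open>w\<close> is nonempty, both sides vanish by the
  convention \<open>inverse 0 = 0\<close>.\<close>

lemma last_pole_Cons:
  "last_pole a (x # w) =
     inverse (x - a) * last_pole a w + (if x = a then counit w else 0)"
  by (auto simp: last_pole_def counit_def)

lemma last_pole_notin: "a \<notin> set w \<Longrightarrow> last_pole a w = 0"
  by (auto simp: last_pole_def)

text \<open>Follows the recursion of \<open>qsh\<close> on the two words alone;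
  \<open>qsh.induct\<close> would also vary the functional, which has to stay fixed in the proofs
  below.\<close>

lemma word_pair_induct [case_names left right Cons]:
  assumes "\<And>w. P [] w" and "\<And>v. P v []"
    and "\<And>a v b w. P v (b # w) \<Longrightarrow> P (a # v) w \<Longrightarrow> P v w \<Longrightarrow> P (a # v) (b # w)"
  shows "P v w"
proof (induction v arbitrary: w)
  case Nil
  show ?case by fact
next
  case (Cons a v)
  note IH = this
  show ?case
  proof (induction w)
    case Nil
    show ?case by fact
  next
    case (Cons b w)
    show ?case by (intro assms(3) IH Cons)
  qed
qed

text \<open>The partial fraction identity behind the stuffle side: it evaluates the merged
  term.\<close>

lemma stuffle_coeff_cancel:
  fixes a x y :: "'a::field"
  assumes "x \<noteq> a" "y \<noteq> a" "x \<noteq> y"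
  shows "inverse (x - y) * (inverse (x - a) - inverse (y - a)) =
    - (inverse (x - a) * inverse (y - a))"
proof -
  have "x - a \<noteq> 0" "y - a \<noteq> 0" "x - y \<noteq> 0" using assms by auto
  then show ?thesis by (simp add: divide_simps)
qed

text \<open>Each of the two unmerged terms contributes the full product of reciprocals, and by
  partial fractions the merged term contributes minus that product: 2 - 1 = 1.\<close>

lemma qsh_recip_prod:
  assumes "distinct (v @ w)" "a \<notin> set v" "a \<notin> set w"
  shows "qsh stuffle_coeff (recip_prod a) v w = recip_prod a v * recip_prod a w"
  using assms
proof (induction v w rule: word_pair_induct)
  case (Cons x v y w)
  have "x \<noteq> a" "y \<noteq> a" "x \<noteq> y"
    using Cons.prems by auto
  note cancel = stuffle_coeff_cancel[OF this]
  let ?r = "recip_prod a v * recip_prod a w"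
  have "qsh stuffle_coeff (recip_prod a) (x # v) (y # w) =
     2 * inverse (x - a) * inverse (y - a) * ?r +
     (inverse (x - y) * (inverse (x - a) - inverse (y - a))) * ?r"
    using Cons by (simp add: qsh_scale) (simp add: algebra_simps)
  then show ?case
    unfolding cancel by (simp add: algebra_simps)
qed simp_all

lemma is_character_recip_prod: "a \<notin> V \<Longrightarrow> is_character stuffle_coeff V (recip_prod a)"
  unfolding is_character_def
  by (intro allI impI qsh_recip_prod) (auto simp: word_in_def)

text \<open>On two nonempty words only the merged term can produce a single letter, and only if both
  words are single letters. Partial fractions with pole 0 then give the product of the two
  values.\<close>

lemma is_character_pole_zero:
  assumes "0 \<notin> V"
  shows "is_character stuffle_coeff V pole_zero"
proof -
  have *: "(\<lambda>u. pole_zero (x # u)) = (\<lambda>u. - inverse x * counit u)" for x :: 'a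
  proof
    fix u show "pole_zero (x # u) = - inverse x * counit u"
      by (cases u) simp_all
  qed
  have *: "qsh stuffle_coeff pole_zero v w = pole_zero v * pole_zero w"
    if "word_in V (v @ w)" for v w
  proof (cases "v = [] \<or> w = []")
    case False
    then obtain x v' y w' where [simp]: "v = x # v'" "w = y # w'"
      by (auto simp: neq_Nil_conv)
    have "x \<noteq> 0" "y \<noteq> 0" "x \<noteq> y"
      using that assms by (auto simp: word_in_append)
    note cancel = stuffle_coeff_cancel[OF this]
    have "qsh stuffle_coeff pole_zero v w =
        - (inverse (x - y) * (inverse (x - 0) - inverse (y - 0))) * (counit v' * counit w')"
      by (simp add: * qsh_scale qsh_counit del: mult_minus_left) (simp add: algebra_simps)
    also have "\<dots> = (- inverse x * counit v') * (- inverse y * counit w')"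
      unfolding cancel by simp
    also have "\<dots> = pole_zero v * pole_zero w"
      using fun_cong[OF *] by simp
    finally show ?thesis .
  qed auto
  then show ?thesis by (simp add: is_character_def)
qed

lemma conv_inverse_pole_zero:
  assumes "0 \<notin> V"
  shows "conv_inverse V (recip_prod 0) pole_zero"
proof -
  have "conv (recip_prod 0) pole_zero w = counit w" if "0 \<notin> set w" for w :: "'a list"
    using that
  proof (induction w)
    case (Cons a w)
    then have "conv (recip_prod 0) pole_zero (a # w) = pole_zero (a # w) + inverse a * counit w"
      by (simp add: conv_Cons conv_scale_left)
    also have "\<dots> = 0" by (cases w) simp_all
    finally show ?case by simp
  qed simp
  then show ?thesis
    using assms by (auto simp: conv_inverse_def word_in_def)
qed

text \<open>If one word starts with \<open>a\<close>, distinctness keeps \<open>a\<close> out of all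
  other positions, so \<open>recip_prod a\<close> is multiplicative on the rest. The term starting
  with \<open>a\<close> then cancels against the merged term. If neither word starts with
  \<open>a\<close>, every term is zero.\<close>

lemma infinitesimal_first_pole: "infinitesimal stuffle_coeff V (first_pole a)"
proof -
  have *: "qsh stuffle_coeff (first_pole a) v w =
      first_pole a v * counit w + counit v * first_pole a w" if d: "distinct (v @ w)" for v w
  proof (cases "v = [] \<or> w = []")
    case False
    then obtain x v' y w' where [simp]: "v = x # v'" "w = y # w'"
      by (auto simp: neq_Nil_conv)
    have recip: "qsh stuffle_coeff (recip_prod a) v'' w'' = recip_prod a v'' * recip_prod a w''"
      if "distinct (v'' @ w'')" "a \<notin> set v''" "a \<notin> set w''" for v'' w''
      using that by (rule qsh_recip_prod)
    consider "x = a" "y \<noteq> a" | "x \<noteq> a" "y = a" | "x \<noteq> a" "y \<noteq> a"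
      using d by auto
    then show ?thesis
    proof cases
      case 1
      then have "inverse (y - a) = - inverse (a - y)"
        by (metis inverse_minus_eq minus_diff_eq)
      with 1 d show ?thesis by (simp add: recip qsh_zero)
    next
      case 2
      with d show ?thesis by (simp add: recip qsh_zero)
    next
      case 3
      then show ?thesis by (simp add: qsh_zero)
    qed
  qed (auto simp: counit_def)
  show ?thesis
    unfolding infinitesimal_def using * by (simp add: word_in_def)
qed

text \<open>If no word starts with \<open>a\<close>, partial fractions cancel the merged term as for
  \<open>recip_prod\<close>. If one does, \<open>a\<close> occurs nowhere else and the tails
  contribute nothing; what remains is a single letter \<open>a\<close>, whose unmerged and merged
  contributions cancel.\<close>

lemma infinitesimal_last_pole: "infinitesimal stuffle_coeff V (last_pole a)"
proof -
  have "qsh stuffle_coeff (last_pole a) v w =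
      last_pole a v * counit w + counit v * last_pole a w" if "distinct (v @ w)" for v w
    using that
  proof (induction v w rule: word_pair_induct)
    case (Cons x v y w)
    have IH: "qsh stuffle_coeff (last_pole a) v (y # w) = counit v * last_pole a (y # w)"
      "qsh stuffle_coeff (last_pole a) (x # v) w = last_pole a (x # v) * counit w"
      "qsh stuffle_coeff (last_pole a) v w = last_pole a v * counit w + counit v * last_pole a w"
      using Cons by auto
    have "qsh stuffle_coeff (last_pole a) (x # v) (y # w) =
      inverse (x - a) * (counit v * last_pole a (y # w)) +
      inverse (y - a) * (last_pole a (x # v) * counit w) +
      inverse (x - y) * ((inverse (x - a) - inverse (y - a)) *
          (last_pole a v * counit w + counit v * last_pole a w) +
        ((if x = a then 1 else 0) - (if y = a then 1 else 0)) * (counit v * counit w))"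
      by (simp add: last_pole_Cons qsh_add qsh_scale qsh_counit qsh_zero IH ring_distribs
        del: last_pole_Nil)
    also have "\<dots> = 0" (is "?lhs = 0")
    proof -
      consider "x = a" "y \<noteq> a" | "x \<noteq> a" "y = a" | "x \<noteq> a" "y \<noteq> a" "x \<noteq> y"
        using Cons.prems by auto
      then show ?thesis
      proof cases
        case 1
        then have "inverse (y - a) = - inverse (a - y)"
          by (metis inverse_minus_eq minus_diff_eq)
        moreover have "last_pole a v = 0" "last_pole a w = 0"
          using Cons.prems 1 by (auto intro: last_pole_notin)
        ultimately show ?thesis using 1 by (simp add: last_pole_Cons)
      next
        case 2
        moreover have "last_pole a v = 0" "last_pole a w = 0"
          using Cons.prems 2 by (auto intro: last_pole_notin)
        ultimately show ?thesis by (simp add: last_pole_Cons)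
      next
        case 3
        let ?r = "last_pole a v * counit w + counit v * last_pole a w"
        have "?lhs = (inverse (x - a) * inverse (y - a) +
            inverse (x - y) * (inverse (x - a) - inverse (y - a))) * ?r"
          using 3 by (simp add: last_pole_Cons) (simp add: ring_distribs mult_ac)
        then show ?thesis
          unfolding stuffle_coeff_cancel[OF 3] by simp
      qed
    qed
    finally show ?case by simp
  qed (auto simp: counit_def)
  then show ?thesis
    by (simp add: infinitesimal_def word_in_def)
qed

subsection \<open>Prefix sums and the shuffle product\<close>

abbreviation shuffle_coeff :: "'a \<Rightarrow> 'a \<Rightarrow> 'b::field" where
  "shuffle_coeff a b \<equiv> 0"

text \<open>Guarantees that the denominators of \<open>prefix_recip\<close> and
  \<open>suffix_recip\<close> do not vanish on words without repetition over
  \<open>V\<close>.\<close>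

definition subset_sums_nonzero :: "'a::comm_monoid_add set \<Rightarrow> bool" where
  "subset_sums_nonzero V \<longleftrightarrow> (\<forall>F\<subseteq>V. finite F \<and> F \<noteq> {} \<longrightarrow> \<Sum>F \<noteq> 0)"

lemma sum_list_neq_0:
  assumes "subset_sums_nonzero V" "word_in V w" "w \<noteq> []"
  shows "sum_list w \<noteq> 0"
  using assms distinct_sum_list_conv_Sum[of w] by (simp add: subset_sums_nonzero_def word_in_def)

section \<open>The character \<open>E\<close> and its convolution inverse\<close>

definition prefix_recip :: "'a::field list \<Rightarrow> 'a" where
  "prefix_recip w = (\<Prod>k<length w. inverse (sum_list (take (Suc k) w)))"

definition suffix_recip :: "'a::field list \<Rightarrow> 'a" where
  "suffix_recip w = (\<Prod>k<length w. - inverse (sum_list (drop k w)))"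

lemma prefix_recip_Nil [simp]: "prefix_recip [] = 1"
  by (simp add: prefix_recip_def)

lemma suffix_recip_simps [simp]:
  "suffix_recip [] = 1" "suffix_recip (a # w) = - inverse (a + sum_list w) * suffix_recip w"
  by (simp_all add: suffix_recip_def prod.lessThan_Suc_shift del: prod.lessThan_Suc)

text \<open>All shuffles of two words have the same letter sum, so a function of that sum is a
  scalar. The function \<open>h\<close> is arbitrary so that the induction can absorb the prepended
  letter into it.\<close>

lemma qsh_sum_list:
  fixes v w :: "'a::comm_monoid_add list"
  shows "qsh shuffle_coeff (\<lambda>u. h (sum_list u) * \<phi> u) v w =
     h (sum_list v + sum_list w) * qsh shuffle_coeff \<phi> v w"
proof (induction v w arbitrary: h \<phi> rule: word_pair_induct)
  case (Cons a v b w)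
  have "qsh shuffle_coeff (\<lambda>u. h (sum_list (a # u)) * \<phi> (a # u)) v (b # w) =
      h (a + (sum_list v + sum_list (b # w))) * qsh shuffle_coeff (\<lambda>u. \<phi> (a # u)) v (b # w)"
    unfolding sum_list.Cons[of a] by (rule Cons(1))
  moreover have "qsh shuffle_coeff (\<lambda>u. h (sum_list (b # u)) * \<phi> (b # u)) (a # v) w =
      h (b + (sum_list (a # v) + sum_list w)) * qsh shuffle_coeff (\<lambda>u. \<phi> (b # u)) (a # v) w"
    unfolding sum_list.Cons[of b] by (rule Cons(2))
  moreover have "a + (sum_list v + sum_list (b # w)) = sum_list (a # v) + sum_list (b # w)"
    "b + (sum_list (a # v) + sum_list w) = sum_list (a # v) + sum_list (b # w)"
    by (simp_all add: add_ac)
  ultimately show ?case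
    by (simp only: qsh.simps ring_distribs) simp
qed simp_all

text \<open>The first factor of \<open>suffix_recip\<close> involves the total sum, hence is common
  to all shuffles and factors out. With \<open>s\<close> and \<open>t\<close> the sums of the two
  words, the induction step is \<open>1 / (s + t) * (1 / s + 1 / t) = 1 / (s * t)\<close>.\<close>

lemma is_character_suffix_recip:
  assumes "subset_sums_nonzero V"
  shows "is_character shuffle_coeff V suffix_recip"
proof -
  have "qsh shuffle_coeff suffix_recip v w = suffix_recip v * suffix_recip w"
    if "word_in V (v @ w)" for v w
    using that
  proof (induction v w rule: word_pair_induct)
    case (Cons a v b w)
    define s t where "s = sum_list (a # v)" and "t = sum_list (b # w)"
    have words: "word_in V (a # v)" "word_in V (b # w)"
      using Cons.prems unfolding word_in_append by auto
    have "s \<noteq> 0" "t \<noteq> 0"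
      unfolding s_def t_def by (rule sum_list_neq_0[OF assms]; use words in simp)+
    moreover have "s + t \<noteq> 0"
      using sum_list_neq_0[OF assms Cons.prems] unfolding s_def t_def sum_list_append by simp
    ultimately have st: "s \<noteq> 0" "t \<noteq> 0" "s + t \<noteq> 0" .
    let ?r = "suffix_recip v * suffix_recip w"
    have *: "qsh shuffle_coeff (\<lambda>u. suffix_recip (c # u)) v' w' =
        - inverse (c + (sum_list v' + sum_list w')) * qsh shuffle_coeff suffix_recip v' w'"
      for c :: 'a and v' w'
      unfolding suffix_recip_simps by (rule qsh_sum_list)
    have IH: "qsh shuffle_coeff suffix_recip v (b # w) = suffix_recip v * suffix_recip (b # w)"
      "qsh shuffle_coeff suffix_recip (a # v) w = suffix_recip (a # v) * suffix_recip w"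
      using Cons by (auto simp: word_in_append)
    have sums: "a + (sum_list v + sum_list (b # w)) = s + t"
      "b + (sum_list (a # v) + sum_list w) = s + t"
      by (simp_all add: s_def t_def add_ac)
    have "qsh shuffle_coeff suffix_recip (a # v) (b # w) =
        - inverse (s + t) * (suffix_recip v * suffix_recip (b # w)) +
        - inverse (s + t) * (suffix_recip (a # v) * suffix_recip w)"
      unfolding qsh.simps * IH sums by simp
    also have "\<dots> = inverse (s + t) * (inverse s + inverse t) * ?r"
      by (simp add: s_def t_def ring_distribs)
    also have "inverse (s + t) * (inverse s + inverse t) = inverse s * inverse t"
      using st by (simp add: field_simps)
    finally show ?case by (simp add: s_def t_def)
  qed simp_all
  then show ?thesis by (simp add: is_character_def)
qed

text \<open>At each cut the total sum is a prefix sum plus a suffix sum. The prefix sum removes the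
  last factor of \<open>prefix_recip\<close>, the suffix sum removes the first factor of
  \<open>suffix_recip\<close> with a sign, and after an index shift the two resulting sums
  cancel.\<close>

lemma conv_inverse_prefix_suffix:
  assumes "subset_sums_nonzero V"
  shows "conv_inverse V prefix_recip suffix_recip"
proof -
  have "conv prefix_recip suffix_recip w = counit w" if w: "word_in V w" for w
  proof (cases w)
    case (Cons a w')
    define n where "n = length w'"
    have len: "length w = Suc n" by (simp add: Cons n_def)
    let ?E = prefix_recip and ?Y = suffix_recip
    have E: "sum_list (take (Suc k) w) * ?E (take (Suc k) w) = ?E (take k w)" if "k \<le> n" for k
    proof -
      have "?E (take (Suc k) w) = inverse (sum_list (take (Suc k) w)) * ?E (take k w)"
        using that len by (simp add: prefix_recip_def min_def mult.commute)
      moreover have "sum_list (take (Suc k) w) \<noteq> 0"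
        by (rule sum_list_neq_0[OF assms]) (use w Cons in \<open>auto intro: word_in_take simp del: take_Suc_Cons\<close>)
      ultimately show ?thesis by simp
    qed
    have Y: "sum_list (drop k w) * ?Y (drop k w) = - ?Y (drop (Suc k) w)" if "k \<le> n" for k
    proof -
      have k: "drop k w = w ! k # drop (Suc k) w"
        using that len by (simp add: Cons_nth_drop_Suc)
      have "sum_list (drop k w) \<noteq> 0"
        by (rule sum_list_neq_0[OF assms word_in_drop[OF w]]) (use that len in simp)
      then show ?thesis unfolding k by simp
    qed
    have "sum_list w * conv ?E ?Y w =
        (\<Sum>k\<le>Suc n. (sum_list (take k w) * ?E (take k w)) * ?Y (drop k w)) +
        (\<Sum>k\<le>Suc n. ?E (take k w) * (sum_list (drop k w) * ?Y (drop k w)))"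
      unfolding conv_def len sum_distrib_left sum.distrib[symmetric]
    proof (intro sum.cong refl)
      fix k
      have "sum_list w = sum_list (take k w) + sum_list (drop k w)"
        by (simp flip: sum_list_append)
      then show "sum_list w * (?E (take k w) * ?Y (drop k w)) =
          (sum_list (take k w) * ?E (take k w)) * ?Y (drop k w) +
          ?E (take k w) * (sum_list (drop k w) * ?Y (drop k w))"
        by (simp add: algebra_simps)
    qed
    also have "(\<Sum>k\<le>Suc n. (sum_list (take k w) * ?E (take k w)) * ?Y (drop k w)) =
        (\<Sum>k\<le>n. ?E (take k w) * ?Y (drop (Suc k) w))"
      unfolding sum.atMost_Suc_shift by (simp add: E)
    also have "(\<Sum>k\<le>Suc n. ?E (take k w) * (sum_list (drop k w) * ?Y (drop k w))) =
        (\<Sum>k\<le>n. - (?E (take k w) * ?Y (drop (Suc k) w)))"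
      using len by (simp add: Y)
    finally have "sum_list w * conv ?E ?Y w = 0"
      by (simp add: sum_negf)
    moreover have "sum_list w \<noteq> 0"
      using sum_list_neq_0[OF assms w] Cons by simp
    ultimately show ?thesis by (simp add: Cons)
  qed simp
  then show ?thesis by (simp add: conv_inverse_def)
qed

lemma conv_inverse_suffix_prefix:
  "subset_sums_nonzero V \<Longrightarrow> conv_inverse V suffix_recip prefix_recip"
  by (rule conv_inverse_commute[OF conv_inverse_prefix_suffix]) simp_all

text \<open>Peeling a first letter changes every factor of \<open>prefix_recip\<close>, so a direct
  induction along \<open>qsh\<close> is awkward; the property is inherited from the inverse
  instead.\<close>

lemma is_character_prefix_recip:
  assumes "subset_sums_nonzero V"
  shows "is_character shuffle_coeff V prefix_recip"
proof (rule is_character_conv_inverse)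
  show "is_character shuffle_coeff V suffix_recip"
    using assms by (rule is_character_suffix_recip)
  show "conv_inverse V prefix_recip suffix_recip"
    using assms by (rule conv_inverse_prefix_suffix)
qed (rule suffix_recip_simps)

definition letter_weight :: "('a \<Rightarrow> 'b::field) \<Rightarrow> 'a list \<Rightarrow> 'b" where
  "letter_weight g w = (case w of [a] \<Rightarrow> g a | _ \<Rightarrow> 0)"

lemma letter_weight_simps [simp]:
  "letter_weight g [] = 0" "letter_weight g [a] = g a" "letter_weight g (a # b # w) = 0"
  by (simp_all add: letter_weight_def)

text \<open>Without merging, shuffles of two nonempty words have length at least two.\<close>

lemma infinitesimal_letter_weight: "infinitesimal shuffle_coeff V (letter_weight g)"
proof -
  have *: "(\<lambda>u. letter_weight g (a # u)) = (\<lambda>u. g a * counit u)" for a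
  proof
    show "letter_weight g (a # u) = g a * counit u" for u by (cases u) simp_all
  qed
  have "qsh shuffle_coeff (letter_weight g) v w =
      letter_weight g v * counit w + counit v * letter_weight g w" for v w
    by (cases v; cases w) (simp_all add: * qsh_scale qsh_counit)
  then show ?thesis by (simp add: infinitesimal_def)
qed

lemma conv_letter_weight_Cons: "conv (letter_weight g) \<psi> (a # w) = g a * \<psi> w"
proof -
  have "(\<lambda>u. letter_weight g (a # u)) = (\<lambda>u. g a * counit u)"
  proof
    show "letter_weight g (a # u) = g a * counit u" for u by (cases u) simp_all
  qed
  then show ?thesis
    by (simp add: conv_Cons conv_scale_left conv_counit_left)
qed

lemma conv_letter_weight_snoc: "conv \<phi> (letter_weight g) (w @ [a]) = \<phi> w * g a"
proof (induction w arbitrary: \<phi>)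
  case (Cons x u)
  have "letter_weight g (x # u @ [a]) = 0" by (cases u) simp_all
  then show ?case by (simp add: conv_Cons Cons)
qed (simp add: conv_Cons)

lemma conv_letter_weight:
  "conv (conv \<phi> (letter_weight g)) \<psi> w =
     (\<Sum>i<length w. \<phi> (take i w) * g (w ! i) * \<psi> (drop (Suc i) w))"
proof (cases w)
  case (Cons a u)
  then have len: "length w = Suc (length u)" by simp
  have "conv (conv \<phi> (letter_weight g)) \<psi> w =
     (\<Sum>i\<le>length u. conv \<phi> (letter_weight g) (take (Suc i) w) * \<psi> (drop (Suc i) w))"
    unfolding conv_def[of "conv _ _"] len sum.atMost_Suc_shift by simp
  also have "\<dots> = (\<Sum>i\<le>length u. \<phi> (take i w) * g (w ! i) * \<psi> (drop (Suc i) w))"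
    by (intro sum.cong refl) (simp add: len take_Suc_conv_app_nth conv_letter_weight_snoc)
  finally show ?thesis unfolding len lessThan_Suc_atMost .
qed simp

subsection \<open>The components of \<open>\<psi>\<close> as infinitesimal characters\<close>

text \<open>Twice \<open>psi_component\<close>, with the power replaced by \<open>g\<close> and the
  variables by arbitrary points of a field, so that one formula serves for \<open>X\<close>, for
  lists of letters and for partial sums.\<close>

definition psi_form :: "('a::field \<Rightarrow> 'a) \<Rightarrow> (nat \<Rightarrow> 'a) \<Rightarrow> nat \<Rightarrow> 'a" where
  "psi_form g x d =
     (\<Sum>i = 1..d.
        g (x i - x (i - 1)) /
          ((\<Prod>a\<in>{0..<i - 1}. x a - x (i - 1)) * (\<Prod>b\<in>{i + 1..d}. x b - x i)) +
        g (x d) /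
          ((\<Prod>a\<in>{1..<i}. x a) * (\<Prod>b\<in>{i..<d}. x b - x d))) +
     (\<Sum>i\<in>{1..<d}.
        g (x 1 - x d) /
          (x d * (\<Prod>a\<in>{2..i}. x a - x 1) * (\<Prod>b\<in>{i + 1..<d}. x b - x d)) -
        g (x (d - 1)) /
          (x d * (\<Prod>a\<in>{1..<i}. x a) * (\<Prod>b\<in>{i..<d - 1}. x b - x (d - 1))))"

lemma psi_form_cong:
  assumes "\<And>i. i \<le> d \<Longrightarrow> x i = y i"
  shows "psi_form g x d = psi_form g y d"
proof -
  have 1: "x (i - Suc 0) = y (i - Suc 0)" if "i \<le> d" for i
    using that by (intro assms) simp
  have 2: "(\<Prod>a = 0..<i - Suc 0. x a - y (i - Suc 0)) = (\<Prod>a = 0..<i - Suc 0. y a - y (i - Suc 0))"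
    if "i \<le> d" for i
    using that by (intro prod.cong) (auto intro!: arg_cong2[where f = "(-)"] assms)
  have 3: "(\<Prod>b = i..<d - Suc 0. x b - y (d - Suc 0)) = (\<Prod>b = i..<d - Suc 0. y b - y (d - Suc 0))" for i
    by (intro prod.cong) (auto intro!: arg_cong2[where f = "(-)"] assms)
  show ?thesis
    by (simp add: psi_form_def assms 1 2 3 cong: sum.cong_simp prod.cong_simp)
qed

text \<open>Factors of a word are addressed by absolute positions, so that indices match those of
  \<open>psi_form\<close> after any number of cuts.\<close>

definition slice :: "'a list \<Rightarrow> nat \<Rightarrow> nat \<Rightarrow> 'a list" where
  "slice w i j = map ((!) w) [i..<j]"

lemma take_conv_slice: "k \<le> length w \<Longrightarrow> take k w = slice w 0 k"
  by (intro nth_equalityI) (simp_all add: slice_def)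

lemma slice_full: "slice w 0 (length w) = w"
  by (simp add: slice_def map_nth)

lemma length_slice [simp]: "length (slice w i j) = j - i"
  by (simp add: slice_def)

lemma slice_eq_Nil_iff [simp]: "slice w i j = [] \<longleftrightarrow> j \<le> i"
  by (auto simp: slice_def)

lemma slice_Cons: "i < j \<Longrightarrow> slice w i j = w ! i # slice w (Suc i) j"
  by (simp add: slice_def upt_conv_Cons)

lemma slice_snoc: "i \<le> j \<Longrightarrow> slice w i (Suc j) = slice w i j @ [w ! j]"
  by (simp add: slice_def)

lemma take_slice: "i + k \<le> j \<Longrightarrow> take k (slice w i j) = slice w i (i + k)"
  by (simp add: slice_def take_map)

lemma drop_slice: "drop k (slice w i j) = slice w (i + k) j"
  by (simp add: slice_def drop_map)

lemma nth_slice: "k < j - i \<Longrightarrow> slice w i j ! k = w ! (i + k)"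
  by (simp add: slice_def)

lemma conv_slice:
  assumes "i \<le> j"
  shows "conv \<phi> \<psi> (slice w i j) = (\<Sum>k\<in>{i..j}. \<phi> (slice w i k) * \<psi> (slice w k j))"
proof -
  have "(\<Sum>k\<in>{i..j}. \<phi> (slice w i k) * \<psi> (slice w k j)) =
      (\<Sum>k\<in>{..j - i}. \<phi> (slice w i (i + k)) * \<psi> (slice w (i + k) j))"
    by (rule sum.reindex_bij_witness[of _ "\<lambda>k. i + k" "\<lambda>k. k - i"]) (use assms in auto)
  then show ?thesis
    using assms by (simp add: conv_def take_slice drop_slice)
qed

lemma recip_prod_slice: "recip_prod c (slice w i j) = inverse (\<Prod>k\<in>{i..<j}. w ! k - c)"
proof -
  have "recip_prod c (slice w i j) = (\<Prod>k\<leftarrow>[i..<j]. inverse (w ! k - c))"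
    by (simp add: recip_prod_def slice_def comp_def)
  also have "\<dots> = (\<Prod>k\<in>{i..<j}. inverse (w ! k - c))"
    by (simp add: prod.distinct_set_conv_list[symmetric])
  finally show ?thesis by (simp add: prod_inversef[symmetric] comp_def)
qed

lemma first_pole_slice:
  "i < j \<Longrightarrow> first_pole a (slice w i j) =
     (if w ! i = a then recip_prod a (slice w (Suc i) j) else 0)"
  by (simp add: slice_Cons)

lemma last_pole_slice:
  "i \<le> j \<Longrightarrow> last_pole a (slice w i (Suc j)) =
     (if w ! j = a then recip_prod a (slice w i j) else 0)"
  by (simp add: slice_snoc last_pole_def)

text \<open>Since \<open>pole_zero\<close> vanishes beyond length one, only the last two cuts
  survive.\<close>

lemma conv_pole_zero_snoc: "conv \<phi> pole_zero (u @ [c]) = \<phi> (u @ [c]) - \<phi> u / c"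
proof (induction u arbitrary: \<phi>)
  case (Cons x u)
  have "pole_zero (x # u @ [c]) = 0" by (cases u) simp_all
  then show ?case by (simp add: conv_Cons Cons)
qed (simp add: conv_Cons divide_inverse)

lemma sum_double_delta:
  fixes f :: "'a \<Rightarrow> 'a \<Rightarrow> 'b::field"
  assumes "finite S" "p \<in> S" "q \<in> S"
  shows "(\<Sum>a\<in>S. \<Sum>b\<in>S. f a b * ((if p = a then r a else 0) * (if q = b then s b else 0))) =
    f p q * (r p * s q)"
proof -
  have "(\<Sum>a\<in>S. \<Sum>b\<in>S. f a b * ((if p = a then r a else 0) * (if q = b then s b else 0))) =
      (\<Sum>a\<in>S. if p = a then f a q * (r a * s q) else 0)"
  proof (intro sum.cong refl)
    fix a
    have "(\<Sum>b\<in>S. f a b * ((if p = a then r a else 0) * (if q = b then s b else 0))) =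
        (\<Sum>b\<in>S. if q = b then f a b * ((if p = a then r a else 0) * s b) else 0)"
      by (intro sum.cong) auto
    then show "(\<Sum>b\<in>S. f a b * ((if p = a then r a else 0) * (if q = b then s b else 0))) =
        (if p = a then f a q * (r a * s q) else 0)"
      using assms by simp
  qed
  then show ?thesis using assms by simp
qed

lemma sum_conv_swap:
  "(\<Sum>a\<in>S. \<Sum>b\<in>S. f a b * conv (F a b) (G a b) (slice w 0 n)) =
     (\<Sum>k\<in>{0..n}. \<Sum>a\<in>S. \<Sum>b\<in>S. f a b * (F a b (slice w 0 k) * G a b (slice w k n)))"
  by (simp add: conv_slice sum_distrib_left sum.swap[of _ _ "{0..n}"])

text \<open>The poles act as Kronecker deltas: only \<open>a\<close> equal to the first and
  \<open>b\<close> equal to the last letter survive. Cuts at either end drop out because a pole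
  vanishes on the empty word.\<close>

lemma sum_first_last_pole:
  assumes "finite S" "set w \<subseteq> S" "length w = Suc n"
  shows "(\<Sum>a\<in>S. \<Sum>b\<in>S. f a b * conv (first_pole a) (last_pole b) w) =
    (\<Sum>k\<in>{1..<Suc n}. f (w ! 0) (w ! n) *
       (recip_prod (w ! 0) (slice w 1 k) * recip_prod (w ! n) (slice w k n)))"
proof -
  have "(\<Sum>a\<in>S. \<Sum>b\<in>S. f a b * conv (first_pole a) (last_pole b) (slice w 0 (Suc n))) =
      (\<Sum>k\<in>{1..<Suc n}. \<Sum>a\<in>S. \<Sum>b\<in>S. f a b *
        (first_pole a (slice w 0 k) * last_pole b (slice w k (Suc n))))"
    unfolding sum_conv_swap
  proof (rule sum.mono_neutral_right)
    show "\<forall>k\<in>{0..Suc n} - {1..<Suc n}. (\<Sum>a\<in>S. \<Sum>b\<in>S. f a b *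
        (first_pole a (slice w 0 k) * last_pole b (slice w k (Suc n)))) = 0"
    proof
      fix k assume "k \<in> {0..Suc n} - {1..<Suc n}"
      then have "slice w 0 k = [] \<or> slice w k (Suc n) = []" by auto
      then show "(\<Sum>a\<in>S. \<Sum>b\<in>S. f a b *
          (first_pole a (slice w 0 k) * last_pole b (slice w k (Suc n)))) = 0"
        by (auto simp del: slice_eq_Nil_iff)
    qed
  qed auto
  also have "\<dots> = (\<Sum>k\<in>{1..<Suc n}. f (w ! 0) (w ! n) *
      (recip_prod (w ! 0) (slice w 1 k) * recip_prod (w ! n) (slice w k n)))"
  proof (intro sum.cong refl)
    fix k assume k: "k \<in> {1..<Suc n}"
    have "w ! 0 \<in> S" "w ! n \<in> S" using assms by auto
    with k assms(1) show "(\<Sum>a\<in>S. \<Sum>b\<in>S. f a b *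
        (first_pole a (slice w 0 k) * last_pole b (slice w k (Suc n)))) = f (w ! 0) (w ! n) *
        (recip_prod (w ! 0) (slice w 1 k) * recip_prod (w ! n) (slice w k n))"
      by (simp add: first_pole_slice last_pole_slice sum_double_delta)
  qed
  finally show ?thesis
    using slice_full[of w] by (simp add: assms(3))
qed

text \<open>In this order the deltas select the two letters adjacent to the cut. This is the source
  of the differences of consecutive variables in \<open>psi_form\<close>.\<close>

lemma sum_last_first_pole:
  assumes "finite S" "set w \<subseteq> S" "length w = Suc n"
  shows "(\<Sum>a\<in>S. \<Sum>b\<in>S. f a b * conv (last_pole b) (first_pole a) w) =
    (\<Sum>k<n. f (w ! Suc k) (w ! k) *
       (recip_prod (w ! k) (slice w 0 k) * recip_prod (w ! Suc k) (slice w (Suc (Suc k)) (Suc n))))"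
proof -
  have "(\<Sum>a\<in>S. \<Sum>b\<in>S. f a b * conv (last_pole b) (first_pole a) (slice w 0 (Suc n))) =
      (\<Sum>k\<in>{1..<Suc n}. \<Sum>a\<in>S. \<Sum>b\<in>S. f a b *
        (last_pole b (slice w 0 k) * first_pole a (slice w k (Suc n))))"
    unfolding sum_conv_swap
  proof (rule sum.mono_neutral_right)
    show "\<forall>k\<in>{0..Suc n} - {1..<Suc n}. (\<Sum>a\<in>S. \<Sum>b\<in>S. f a b *
        (last_pole b (slice w 0 k) * first_pole a (slice w k (Suc n)))) = 0"
    proof
      fix k assume "k \<in> {0..Suc n} - {1..<Suc n}"
      then have "slice w 0 k = [] \<or> slice w k (Suc n) = []" by auto
      then show "(\<Sum>a\<in>S. \<Sum>b\<in>S. f a b *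
          (last_pole b (slice w 0 k) * first_pole a (slice w k (Suc n)))) = 0"
        by (auto simp del: slice_eq_Nil_iff)
    qed
  qed auto
  also have "\<dots> = (\<Sum>k<n. \<Sum>a\<in>S. \<Sum>b\<in>S. f a b *
        (first_pole a (slice w (Suc k) (Suc n)) * last_pole b (slice w 0 (Suc k))))"
    by (rule sum.reindex_bij_witness[of _ Suc "\<lambda>k. k - 1"]) (auto simp: mult_ac)
  also have "\<dots> = (\<Sum>k<n. f (w ! Suc k) (w ! k) *
       (recip_prod (w ! Suc k) (slice w (Suc (Suc k)) (Suc n)) * recip_prod (w ! k) (slice w 0 k)))"
  proof (intro sum.cong refl)
    fix k assume k: "k \<in> {..<n}"
    then have "w ! k \<in> S" "w ! Suc k \<in> S" using assms by auto
    with k assms(1) show "(\<Sum>a\<in>S. \<Sum>b\<in>S. f a b *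
        (first_pole a (slice w (Suc k) (Suc n)) * last_pole b (slice w 0 (Suc k)))) =
        f (w ! Suc k) (w ! k) *
       (recip_prod (w ! Suc k) (slice w (Suc (Suc k)) (Suc n)) * recip_prod (w ! k) (slice w 0 k))"
      by (simp add: first_pole_slice last_pole_slice sum_double_delta)
  qed
  finally show ?thesis
    using slice_full[of w] by (simp add: assms(3) mult_ac)
qed

text \<open>Splits the formula into four sums with half-open ranges and without truncated
  subtraction, ready to be matched one by one with the pieces of a generator.\<close>

lemma psi_form_Suc:
  fixes x :: "nat \<Rightarrow> 'a::field"
  shows "psi_form g x (Suc n) =
     (\<Sum>k<Suc n. g (x (Suc k) - x k) /
        ((\<Prod>a\<in>{0..<k}. x a - x k) * (\<Prod>b\<in>{Suc (Suc k)..<Suc (Suc n)}. x b - x (Suc k)))) +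
     (\<Sum>k<Suc n. g (x (Suc n)) /
        ((\<Prod>a\<in>{Suc 0..<Suc k}. x a) * (\<Prod>b\<in>{Suc k..<Suc n}. x b - x (Suc n)))) +
     (\<Sum>k\<in>{1..<Suc n}. g (x (Suc 0) - x (Suc n)) /
        (x (Suc n) * (\<Prod>a\<in>{Suc (Suc 0)..<Suc k}. x a - x (Suc 0)) *
          (\<Prod>b\<in>{Suc k..<Suc n}. x b - x (Suc n)))) -
     (\<Sum>k<n. g (x n) /
        (x (Suc n) * (\<Prod>a\<in>{Suc 0..<Suc k}. x a) * (\<Prod>b\<in>{Suc k..<n}. x b - x n)))"
proof -
  have *: "(\<Sum>i\<in>{Suc 0..<Suc m}. F i) = (\<Sum>k<m. F (Suc k))"
    for F :: "nat \<Rightarrow> 'a" and m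
    by (simp add: sum.shift_bounds_Suc_ivl lessThan_atLeast0 del: sum.op_ivl_Suc)
  show ?thesis
    unfolding psi_form_def sum.distrib sum_subtractf One_nat_def
      numeral_2_eq_2 atLeastLessThanSuc_atLeastAtMost[symmetric]
    by (simp add: * add_diff_eq del: sum.op_ivl_Suc prod.op_ivl_Suc sum.lessThan_Suc)
qed

text \<open>The finite set \<open>S\<close> stands for all letters: letters of \<open>S\<close> that
  do not occur in \<open>w\<close> contribute zero.\<close>

definition stuffle_generator :: "('a::field \<Rightarrow> 'a) \<Rightarrow> 'a set \<Rightarrow> 'a list \<Rightarrow> 'a" where
  "stuffle_generator g S w =
     (\<Sum>a\<in>S. g a * first_pole a w) +
     (\<Sum>a\<in>S. g a * conv (conv (recip_prod 0) (last_pole a)) pole_zero w) +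
     (\<Sum>a\<in>S. \<Sum>b\<in>S. g (a - b) / b *
        (conv (first_pole a) (last_pole b) w - conv (last_pole b) (first_pole a) w))"

lemma infinitesimal_stuffle_generator:
  assumes "0 \<notin> V"
  shows "infinitesimal stuffle_coeff V (stuffle_generator g S)"
  unfolding stuffle_generator_def
  by (intro infinitesimal_add infinitesimal_sum infinitesimal_scale infinitesimal_commutator
      infinitesimal_first_pole infinitesimal_last_pole infinitesimal_conjugate
      is_character_recip_prod is_character_pole_zero conv_inverse_pole_zero assms)

lemma sum_conv_last_pole:
  assumes "finite S" "w ! m \<in> S"
  shows "(\<Sum>a\<in>S. g a * conv (recip_prod 0) (last_pole a) (slice w 0 (Suc m))) =
    (\<Sum>k<Suc m. g (w ! m) * (recip_prod 0 (slice w 0 k) * recip_prod (w ! m) (slice w k m)))"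
proof -
  have "(\<Sum>a\<in>S. g a * conv (recip_prod 0) (last_pole a) (slice w 0 (Suc m))) =
      (\<Sum>k\<in>{0..Suc m}. \<Sum>a\<in>S. g a * (recip_prod 0 (slice w 0 k) * last_pole a (slice w k (Suc m))))"
    by (simp add: conv_slice sum_distrib_left sum.swap[of _ _ "{0..Suc m}"] del: sum.cl_ivl_Suc)
  also have "\<dots> =
      (\<Sum>k\<in>{..<Suc m}. \<Sum>a\<in>S. g a * (recip_prod 0 (slice w 0 k) * last_pole a (slice w k (Suc m))))"
  proof (rule sum.mono_neutral_right)
    show "\<forall>k\<in>{0..Suc m} - {..<Suc m}.
        (\<Sum>a\<in>S. g a * (recip_prod 0 (slice w 0 k) * last_pole a (slice w k (Suc m)))) = 0"
    proof
      fix k assume "k \<in> {0..Suc m} - {..<Suc m}"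
      then have "slice w k (Suc m) = []" by auto
      then show "(\<Sum>a\<in>S. g a *
          (recip_prod 0 (slice w 0 k) * last_pole a (slice w k (Suc m)))) = 0"
        by (simp del: slice_eq_Nil_iff)
    qed
  qed auto
  also have "\<dots> =
    (\<Sum>k<Suc m. g (w ! m) * (recip_prod 0 (slice w 0 k) * recip_prod (w ! m) (slice w k m)))"
  proof (intro sum.cong refl)
    fix k assume k: "k \<in> {..<Suc m}"
    have "(\<Sum>a\<in>S. g a * (recip_prod 0 (slice w 0 k) * last_pole a (slice w k (Suc m)))) =
        (\<Sum>a\<in>S. if w ! m = a then g a * (recip_prod 0 (slice w 0 k) * recip_prod a (slice w k m)) else 0)"
      using k by (intro sum.cong) (auto simp: last_pole_slice)
    then show "(\<Sum>a\<in>S. g a * (recip_prod 0 (slice w 0 k) * last_pole a (slice w k (Suc m)))) =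
        g (w ! m) * (recip_prod 0 (slice w 0 k) * recip_prod (w ! m) (slice w k m))"
      using assms by simp
  qed
  finally show ?thesis .
qed

text \<open>\<open>A\<close> holds the first poles together with the products of a last by a first
  pole, and \<open>C\<close> the products in the opposite order. \<open>B\<close> and
  \<open>D\<close> are the two cuts that \<open>pole_zero\<close> leaves of the conjugated last
  poles.\<close>

lemma psi_form_eq_stuffle_generator:
  assumes "finite S" "set w \<subseteq> S" "w \<noteq> []"
  shows "psi_form g (\<lambda>i. (0 # w) ! i) (length w) = stuffle_generator g S w"
proof -
  obtain n where n: "length w = Suc n" using assms(3) by (cases w) auto
  have in_S: "w ! k \<in> S" if "k \<le> n" for k using that n assms(2) by auto
  let ?L = "\<lambda>u. \<Sum>a\<in>S. g a * conv (recip_prod 0) (last_pole a) u"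
  let ?C = "\<Sum>a\<in>S. \<Sum>b\<in>S. g (a - b) / b * conv (first_pole a) (last_pole b) w"
  let ?N = "\<Sum>a\<in>S. \<Sum>b\<in>S. g (a - b) / b * conv (last_pole b) (first_pole a) w"
  let ?x = "\<lambda>i. (0 # w) ! i"
  have w: "w = slice w 0 n @ [w ! n]" "w = slice w 0 (Suc n)"
    using slice_full[of w] by (simp_all add: n slice_snoc)
  have first: "(\<Sum>a\<in>S. g a * first_pole a w) =
      g (w ! 0) * recip_prod (w ! 0) (slice w 1 (Suc n))"
  proof -
    have "(\<Sum>a\<in>S. g a * first_pole a (slice w 0 (Suc n))) =
        (\<Sum>a\<in>S. if w ! 0 = a then g a * recip_prod a (slice w 1 (Suc n)) else 0)"
      by (intro sum.cong) (auto simp: first_pole_slice)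
    then show ?thesis using assms(1) in_S by (simp flip: w(2))
  qed
  have "(\<Sum>a\<in>S. g a * conv (conv (recip_prod 0) (last_pole a)) pole_zero (slice w 0 n @ [w ! n])) =
      ?L (slice w 0 n @ [w ! n]) - ?L (slice w 0 n) / w ! n"
    by (simp add: conv_pole_zero_snoc right_diff_distrib sum_subtractf sum_divide_distrib)
  then have gen: "stuffle_generator g S w =
      (\<Sum>a\<in>S. g a * first_pole a w) + (?L w - ?L (slice w 0 n) / w ! n) + (?C - ?N)"
    by (simp add: stuffle_generator_def right_diff_distrib sum_subtractf flip: w(1))
  have A: "(\<Sum>k<Suc n. g (?x (Suc k) - ?x k) /
        ((\<Prod>a\<in>{0..<k}. ?x a - ?x k) * (\<Prod>b\<in>{Suc (Suc k)..<Suc (Suc n)}. ?x b - ?x (Suc k)))) =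
      (\<Sum>a\<in>S. g a * first_pole a w) - ?N"
  proof -
    \<comment> \<open>The factor with index 0 in the first product is \<open>0 - w ! k\<close>; it
      supplies both the coefficient \<open>1 / b\<close> and the sign of \<open>?N\<close>.\<close>
    have "(\<Sum>k<n. g (?x (Suc (Suc k)) - ?x (Suc k)) /
        ((\<Prod>a\<in>{0..<Suc k}. ?x a - ?x (Suc k)) *
          (\<Prod>b\<in>{Suc (Suc (Suc k))..<Suc (Suc n)}. ?x b - ?x (Suc (Suc k))))) = - ?N"
      unfolding sum_last_first_pole[OF assms(1,2) n] sum_negf[symmetric]
      by (intro sum.cong refl)
        (simp add: prod.atLeast0_lessThan_Suc_shift prod.shift_bounds_Suc_ivl recip_prod_slice
          divide_inverse del: prod.op_ivl_Suc)
    moreover have "g (?x (Suc 0) - ?x 0) / ((\<Prod>a\<in>{0..<0}. ?x a - ?x 0) *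
          (\<Prod>b\<in>{Suc (Suc 0)..<Suc (Suc n)}. ?x b - ?x (Suc 0))) = (\<Sum>a\<in>S. g a * first_pole a w)"
      unfolding first
      by (simp add: prod.shift_bounds_Suc_ivl recip_prod_slice divide_inverse del: prod.op_ivl_Suc)
    ultimately show ?thesis
      unfolding sum.lessThan_Suc_shift by simp
  qed
  have B: "(\<Sum>k<Suc n. g (?x (Suc n)) /
        ((\<Prod>a\<in>{Suc 0..<Suc k}. ?x a) * (\<Prod>b\<in>{Suc k..<Suc n}. ?x b - ?x (Suc n)))) = ?L w"
    \<comment> \<open>The fifth occurrence of \<open>w\<close> is the argument of \<open>?L\<close>;
      the earlier ones are hidden in \<open>?x\<close>.\<close>
    apply (subst (5) w(2))
    unfolding sum_conv_last_pole[OF assms(1) in_S[OF order_refl]]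
    by (intro sum.cong refl)
      (simp add: prod.shift_bounds_Suc_ivl recip_prod_slice divide_inverse del: prod.op_ivl_Suc)
  have C: "(\<Sum>k\<in>{1..<Suc n}. g (?x (Suc 0) - ?x (Suc n)) /
        (?x (Suc n) * (\<Prod>a\<in>{Suc (Suc 0)..<Suc k}. ?x a - ?x (Suc 0)) *
          (\<Prod>b\<in>{Suc k..<Suc n}. ?x b - ?x (Suc n)))) = ?C"
    unfolding sum_first_last_pole[OF assms(1,2) n]
    by (intro sum.cong refl)
      (simp add: prod.shift_bounds_Suc_ivl recip_prod_slice divide_inverse del: prod.op_ivl_Suc)
  have D: "(\<Sum>k<n. g (?x n) /
        (?x (Suc n) * (\<Prod>a\<in>{Suc 0..<Suc k}. ?x a) * (\<Prod>b\<in>{Suc k..<n}. ?x b - ?x n))) =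
      ?L (slice w 0 n) / w ! n"
  proof (cases n)
    case 0
    then have "slice w 0 n = []" by simp
    then show ?thesis using 0 by (simp del: slice_eq_Nil_iff)
  next
    case (Suc m)
    then have "w ! m \<in> S" using in_S by simp
    then show ?thesis
      unfolding Suc sum_conv_last_pole[OF assms(1) \<open>w ! m \<in> S\<close>] sum_divide_distrib
      by (intro sum.cong refl)
        (simp add: prod.shift_bounds_Suc_ivl recip_prod_slice divide_inverse del: prod.op_ivl_Suc)
  qed
  show ?thesis
    unfolding n psi_form_Suc A B C D gen by simp
qed

section \<open>The shuffle side: letters as increments of the variables\<close>

lemma sum_list_slice:
  fixes y :: "'a::ab_group_add list"
  assumes "i \<le> j" "j \<le> length y"
  shows "sum_list (slice y i j) = sum_list (take j y) - sum_list (take i y)"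
proof -
  have "take j y = slice y 0 j" "take i y = slice y 0 i"
    using assms by (simp_all add: take_conv_slice)
  moreover have "slice y 0 j = slice y 0 i @ slice y i j"
    using assms upt_add_eq_append[of 0 i "j - i"] by (simp add: slice_def flip: map_append)
  ultimately show ?thesis by simp
qed

lemma prefix_recip_slice:
  assumes "i \<le> j" "j \<le> length y"
  shows "prefix_recip (slice y i j) =
    inverse (\<Prod>b\<in>{Suc i..<Suc j}. sum_list (take b y) - sum_list (take i y))"
proof -
  have "prefix_recip (slice y i j) =
      (\<Prod>k<j - i. inverse (sum_list (take (Suc (i + k)) y) - sum_list (take i y)))"
    unfolding prefix_recip_def length_slice
    using assms by (intro prod.cong refl) (simp add: take_slice sum_list_slice)
  also have "\<dots> = (\<Prod>b\<in>{Suc i..<Suc j}. inverse (sum_list (take b y) - sum_list (take i y)))"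
    by (rule prod.reindex_bij_witness[of _ "\<lambda>b. b - Suc i" "\<lambda>k. Suc (i + k)"]) auto
  finally show ?thesis by (simp add: prod_inversef[symmetric] comp_def)
qed

text \<open>The sign carried by each factor of \<open>suffix_recip\<close> orients the differences
  as they appear in \<open>psi_form\<close>.\<close>

lemma suffix_recip_slice:
  assumes "i \<le> j" "j \<le> length y"
  shows "suffix_recip (slice y i j) =
    inverse (\<Prod>a\<in>{i..<j}. sum_list (take a y) - sum_list (take j y))"
proof -
  have "suffix_recip (slice y i j) =
      (\<Prod>k<j - i. inverse (sum_list (take (i + k) y) - sum_list (take j y)))"
    unfolding suffix_recip_def length_slice
    using assms by (intro prod.cong refl)
      (simp add: drop_slice sum_list_slice inverse_minus_eq[symmetric] del: inverse_minus_eq)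
  also have "\<dots> = (\<Prod>a\<in>{i..<j}. inverse (sum_list (take a y) - sum_list (take j y)))"
    by (rule prod.reindex_bij_witness[of _ "\<lambda>b. b - i" "\<lambda>k. i + k"]) auto
  finally show ?thesis by (simp add: prod_inversef[symmetric] comp_def)
qed

lemma conv_letter_weight_slice:
  "conv (conv \<phi> (letter_weight g)) \<psi> (slice w i j) =
     (\<Sum>k\<in>{i..<j}. \<phi> (slice w i k) * g (w ! k) * \<psi> (slice w (Suc k) j))"
proof -
  have "(\<Sum>k\<in>{i..<j}. \<phi> (slice w i k) * g (w ! k) * \<psi> (slice w (Suc k) j)) =
      (\<Sum>k<j - i. \<phi> (slice w i (i + k)) * g (w ! (i + k)) * \<psi> (slice w (Suc (i + k)) j))"
    by (rule sum.reindex_bij_witness[of _ "\<lambda>k. i + k" "\<lambda>k. k - i"]) auto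
  then show ?thesis
    by (simp add: conv_letter_weight take_slice drop_slice nth_slice)
qed

definition conjugate_unit :: "'a::field list \<Rightarrow> 'a" where
  "conjugate_unit = conv (conv prefix_recip (letter_weight (\<lambda>a. 1))) suffix_recip"

text \<open>The total \<open>T\<close> of the overview becomes a parameter \<open>t\<close>
  independent of the word, so \<open>g t\<close> and \<open>inverse t\<close> are scalars and
  linearity applies; \<open>conjugate_unit\<close> is \<open>Z\<close>.\<close>

definition shuffle_generator :: "('a::field \<Rightarrow> 'a) \<Rightarrow> 'a \<Rightarrow> 'a list \<Rightarrow> 'a" where
  "shuffle_generator g t w =
     conv (conv suffix_recip (letter_weight g)) prefix_recip w + g t * conjugate_unit w +
     inverse t * (conv (letter_weight (\<lambda>a. g (t - a))) conjugate_unit w -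
       conv conjugate_unit (letter_weight (\<lambda>a. g (t - a))) w)"

lemma infinitesimal_shuffle_generator:
  assumes "subset_sums_nonzero V"
  shows "infinitesimal shuffle_coeff V (shuffle_generator g t)"
proof -
  note characters = is_character_prefix_recip[OF assms] is_character_suffix_recip[OF assms]
    conv_inverse_prefix_suffix[OF assms] conv_inverse_suffix_prefix[OF assms]
  have unit: "infinitesimal shuffle_coeff V (conjugate_unit :: 'a list \<Rightarrow> 'a)"
    unfolding conjugate_unit_def
    by (rule infinitesimal_conjugate) (rule characters infinitesimal_letter_weight)+
  have "infinitesimal shuffle_coeff V
      (conv (conv suffix_recip (letter_weight g)) (prefix_recip :: 'a list \<Rightarrow> 'a))"
    by (rule infinitesimal_conjugate) (rule characters infinitesimal_letter_weight)+
  with unit show ?thesis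
    unfolding shuffle_generator_def
    by (intro infinitesimal_add infinitesimal_scale infinitesimal_commutator
        infinitesimal_letter_weight)
qed

lemma conjugate_unit_slice:
  assumes "i \<le> j" "j \<le> length y"
  shows "conjugate_unit (slice y i j) =
    (\<Sum>k\<in>{i..<j}.
       inverse (\<Prod>b\<in>{Suc i..<Suc k}. sum_list (take b y) - sum_list (take i y)) *
       inverse (\<Prod>a\<in>{Suc k..<j}. sum_list (take a y) - sum_list (take j y)))"
  unfolding conjugate_unit_def conv_letter_weight_slice
  using assms by (intro sum.cong refl) (simp add: prefix_recip_slice suffix_recip_slice del: prod.op_ivl_Suc)

text \<open>The points are the partial sums of \<open>y\<close>. \<open>A\<close> is the conjugate
  of \<open>letter_weight g\<close>, \<open>B\<close> the multiple of \<open>conjugate_unit\<close>,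
  and \<open>C\<close> and \<open>D\<close> are the two halves of the commutator.\<close>

lemma psi_form_eq_shuffle_generator:
  assumes "y \<noteq> []" and even: "\<And>s. g (- s) = g s"
  shows "psi_form g (\<lambda>i. sum_list (take i y)) (length y) = shuffle_generator g (sum_list y) y"
proof -
  obtain n where n: "length y = Suc n" using assms(1) by (cases y) auto
  let ?x = "\<lambda>i. sum_list (take i y)"
  let ?h = "\<lambda>a. g (sum_list y - a)"
  have y: "y = slice y 0 (Suc n)" using slice_full[of y] by (simp add: n)
  have y_Cons: "y = y ! 0 # slice y (Suc 0) (Suc n)"
    using y slice_Cons[of 0 "Suc n" y] by simp
  have y_snoc: "y = slice y 0 n @ [y ! n]"
    using y slice_snoc[of 0 n y] by simp
  have x_Suc: "?x (Suc k) = ?x k + y ! k" if "k \<le> n" for k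
    using that n by (simp add: take_Suc_conv_app_nth)
  have total: "?x (Suc n) = sum_list y" using n by simp
  have A: "(\<Sum>k<Suc n. g (?x (Suc k) - ?x k) /
        ((\<Prod>a\<in>{0..<k}. ?x a - ?x k) * (\<Prod>b\<in>{Suc (Suc k)..<Suc (Suc n)}. ?x b - ?x (Suc k)))) =
      conv (conv suffix_recip (letter_weight g)) prefix_recip (slice y 0 (Suc n))"
    unfolding conv_letter_weight_slice lessThan_atLeast0
    by (intro sum.cong refl)
      (simp add: x_Suc n suffix_recip_slice prefix_recip_slice divide_inverse mult_ac
        del: prod.op_ivl_Suc)
  have B: "(\<Sum>k<Suc n. g (?x (Suc n)) /
        ((\<Prod>a\<in>{Suc 0..<Suc k}. ?x a) * (\<Prod>b\<in>{Suc k..<Suc n}. ?x b - ?x (Suc n)))) =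
      g (sum_list y) * conjugate_unit (slice y 0 (Suc n))"
    by (simp add: conjugate_unit_slice n total lessThan_atLeast0 sum_distrib_left divide_inverse
        mult_ac del: prod.op_ivl_Suc sum.op_ivl_Suc)
  have "conv (letter_weight ?h) conjugate_unit (y ! 0 # slice y (Suc 0) (Suc n)) =
      g (sum_list y - y ! 0) * conjugate_unit (slice y (Suc 0) (Suc n))"
    by (rule conv_letter_weight_Cons)
  \<comment> \<open>Evenness enters here: the total minus the first letter is the last point minus
    the first, while \<open>psi_form\<close> has the opposite difference.\<close>
  moreover have "g (sum_list y - y ! 0) = g (?x (Suc 0) - ?x (Suc n))"
    using even[of "sum_list y - y ! 0"] x_Suc[of 0] n by simp
  ultimately have C: "(\<Sum>k\<in>{1..<Suc n}. g (?x (Suc 0) - ?x (Suc n)) /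
        (?x (Suc n) * (\<Prod>a\<in>{Suc (Suc 0)..<Suc k}. ?x a - ?x (Suc 0)) *
          (\<Prod>b\<in>{Suc k..<Suc n}. ?x b - ?x (Suc n)))) =
      inverse (sum_list y) * conv (letter_weight ?h) conjugate_unit y"
    unfolding y_Cons[symmetric]
    by (simp add: conjugate_unit_slice n total sum_distrib_left divide_inverse
        mult_ac del: prod.op_ivl_Suc sum.op_ivl_Suc)
  have "conv conjugate_unit (letter_weight ?h) (slice y 0 n @ [y ! n]) =
      conjugate_unit (slice y 0 n) * g (sum_list y - y ! n)"
    by (rule conv_letter_weight_snoc)
  moreover have "g (sum_list y - y ! n) = g (?x n)"
    using x_Suc[of n] n by simp
  ultimately have D: "(\<Sum>k<n. g (?x n) /
        (?x (Suc n) * (\<Prod>a\<in>{Suc 0..<Suc k}. ?x a) * (\<Prod>b\<in>{Suc k..<n}. ?x b - ?x n))) =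
      inverse (sum_list y) * conv conjugate_unit (letter_weight ?h) y"
    unfolding y_snoc[symmetric]
    by (simp add: conjugate_unit_slice n total lessThan_atLeast0 sum_distrib_left divide_inverse
        mult_ac del: prod.op_ivl_Suc sum.op_ivl_Suc)
  show ?thesis
    unfolding n psi_form_Suc A B C D shuffle_generator_def
    by (simp add: algebra_simps flip: y)
qed

subsection \<open>Evaluation of rational functions\<close>

lemma mpoly_induct [case_names zero single_add]:
  fixes P :: "'a::zero \<Rightarrow>\<^sub>0 'b::monoid_add"
  assumes "\<phi> 0" and "\<And>m c P. \<phi> P \<Longrightarrow> \<phi> (Poly_Mapping.single m c + P)"
  shows "\<phi> P"
proof (induction P rule: update_induct)
  case (update P m c)
  have "Poly_Mapping.update m c P = Poly_Mapping.single m c + P"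
    using update(1)
    by (intro poly_mapping_eqI)
      (auto simp: lookup_update lookup_add lookup_single when_def in_keys_iff)
  then show ?case using assms(2)[OF update(3)] by simp
qed fact

lemma ratconst_simps [simp]:
  "ratconst 0 = 0" "ratconst 1 = 1" "ratconst (a + b) = ratconst a + ratconst b"
  "ratconst (a * b) = ratconst a * ratconst b"
  by (simp_all add: ratconst_def fract_collapse single_add mult_single)

definition eval_monom :: "(nat \<Rightarrow> ratfun) \<Rightarrow> (nat \<Rightarrow>\<^sub>0 nat) \<Rightarrow> ratfun" where
  "eval_monom \<sigma> m = (\<Prod>i\<in>Poly_Mapping.keys m. \<sigma> i ^ Poly_Mapping.lookup m i)"

lemma eval_monom_superset:
  "finite S \<Longrightarrow> Poly_Mapping.keys m \<subseteq> S \<Longrightarrow> eval_monom \<sigma> m = (\<Prod>i\<in>S. \<sigma> i ^ Poly_Mapping.lookup m i)"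
  unfolding eval_monom_def by (rule prod.mono_neutral_left) (auto simp: in_keys_iff)

lemma eval_monom_add: "eval_monom \<sigma> (m + m') = eval_monom \<sigma> m * eval_monom \<sigma> m'"
proof -
  let ?S = "Poly_Mapping.keys m \<union> Poly_Mapping.keys m'"
  have "eval_monom \<sigma> (m + m') = (\<Prod>i\<in>?S. \<sigma> i ^ Poly_Mapping.lookup (m + m') i)"
    by (rule eval_monom_superset) (use keys_add[of m m'] in auto)
  also have "\<dots> = eval_monom \<sigma> m * eval_monom \<sigma> m'"
    by (simp add: eval_monom_superset[of ?S] lookup_add power_add prod.distrib)
  finally show ?thesis .
qed

lemma eval_mpoly_superset:
  "finite S \<Longrightarrow> Poly_Mapping.keys P \<subseteq> S \<Longrightarrow>
     eval_mpoly \<sigma> P = (\<Sum>m\<in>S. ratconst (Poly_Mapping.lookup P m) * eval_monom \<sigma> m)"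
  unfolding eval_mpoly_def eval_monom_def
  by (rule sum.mono_neutral_left) (auto simp: in_keys_iff)

lemma eval_mpoly_add: "eval_mpoly \<sigma> (P + Q) = eval_mpoly \<sigma> P + eval_mpoly \<sigma> Q"
proof -
  let ?S = "Poly_Mapping.keys P \<union> Poly_Mapping.keys Q"
  have "eval_mpoly \<sigma> (P + Q) =
      (\<Sum>m\<in>?S. ratconst (Poly_Mapping.lookup (P + Q) m) * eval_monom \<sigma> m)"
    by (rule eval_mpoly_superset) (use keys_add[of P Q] in auto)
  also have "\<dots> = eval_mpoly \<sigma> P + eval_mpoly \<sigma> Q"
    by (simp add: eval_mpoly_superset[of ?S] lookup_add ring_distribs sum.distrib)
  finally show ?thesis .
qed

lemma eval_mpoly_single: "eval_mpoly \<sigma> (Poly_Mapping.single m c) = ratconst c * eval_monom \<sigma> m"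
  by (subst eval_mpoly_superset[of "{m}"]) auto

lemma eval_mpoly_0 [simp]: "eval_mpoly \<sigma> 0 = 0"
  by (simp add: eval_mpoly_def)

lemma eval_mpoly_1 [simp]: "eval_mpoly \<sigma> 1 = 1"
  using eval_mpoly_single[of \<sigma> 0 1] by (simp add: eval_monom_def)

lemma eval_mpoly_mult: "eval_mpoly \<sigma> (P * Q) = eval_mpoly \<sigma> P * eval_mpoly \<sigma> Q"
proof (induction P rule: mpoly_induct)
  case (single_add m c P)
  have "eval_mpoly \<sigma> (Poly_Mapping.single m c * Q) =
      eval_mpoly \<sigma> (Poly_Mapping.single m c) * eval_mpoly \<sigma> Q"
    by (induction Q rule: mpoly_induct)
      (simp_all add: ring_distribs mult_single eval_mpoly_add eval_mpoly_single eval_monom_add)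
  with single_add show ?case by (simp add: ring_distribs eval_mpoly_add)
qed simp

lemma eval_mpoly_uminus: "eval_mpoly \<sigma> (- P) = - eval_mpoly \<sigma> P"
  using eval_mpoly_add[of \<sigma> P "- P"] by (simp add: eq_neg_iff_add_eq_0 add.commute)

text \<open>The relation under the description operator in \<open>subst_ratfun\<close>. As a
  relation it can be composed through the field operations, with a side condition only at
  division.\<close>

definition evaluates_to :: "(nat \<Rightarrow> ratfun) \<Rightarrow> ratfun \<Rightarrow> ratfun \<Rightarrow> bool" where
  "evaluates_to \<sigma> r z \<longleftrightarrow>
     (\<exists>P Q. r = Fract P Q \<and> eval_mpoly \<sigma> Q \<noteq> 0 \<and> z = eval_mpoly \<sigma> P / eval_mpoly \<sigma> Q)"

text \<open>Equality of fractions is a polynomial identity after cross-multiplication, and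
  \<open>eval_mpoly\<close> is multiplicative.\<close>

lemma evaluates_to_unique:
  assumes "evaluates_to \<sigma> r z" "evaluates_to \<sigma> r z'"
  shows "z = z'"
proof -
  obtain P Q where 1: "r = Fract P Q" "eval_mpoly \<sigma> Q \<noteq> 0" "z = eval_mpoly \<sigma> P / eval_mpoly \<sigma> Q"
    using assms(1) by (auto simp: evaluates_to_def)
  obtain P' Q' where 2: "r = Fract P' Q'" "eval_mpoly \<sigma> Q' \<noteq> 0"
    "z' = eval_mpoly \<sigma> P' / eval_mpoly \<sigma> Q'"
    using assms(2) by (auto simp: evaluates_to_def)
  note r = 1(1) 2(1) and nz = 1(2) 2(2) and z = 1(3) 2(3)
  have "Q \<noteq> 0" "Q' \<noteq> 0" using nz by auto
  then have "P * Q' = P' * Q" using r eq_fract(1) by metis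
  then have "eval_mpoly \<sigma> P * eval_mpoly \<sigma> Q' = eval_mpoly \<sigma> P' * eval_mpoly \<sigma> Q"
    by (metis eval_mpoly_mult)
  then show ?thesis using nz by (simp add: z frac_eq_eq)
qed

lemma evaluates_to_Fract_1: "evaluates_to \<sigma> (Fract P 1) (eval_mpoly \<sigma> P)"
  unfolding evaluates_to_def by (intro exI[of _ P] exI[of _ 1]) simp

lemma evaluates_to_0: "evaluates_to \<sigma> 0 0"
  and evaluates_to_1: "evaluates_to \<sigma> 1 1"
  using evaluates_to_Fract_1[of \<sigma> 0] evaluates_to_Fract_1[of \<sigma> 1] by (simp_all add: fract_collapse)

lemma evaluates_to_X: "\<sigma> 0 = 0 \<Longrightarrow> evaluates_to \<sigma> (X i) (\<sigma> i)"
  using evaluates_to_Fract_1[of \<sigma> "Poly_Mapping.single (Poly_Mapping.single i 1) 1"]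
  by (auto simp: X_def evaluates_to_0 eval_mpoly_single eval_monom_def)

lemma evaluates_to_add:
  assumes "evaluates_to \<sigma> r z" "evaluates_to \<sigma> r' z'"
  shows "evaluates_to \<sigma> (r + r') (z + z')"
proof -
  obtain P Q P' Q' where r: "r = Fract P Q" "r' = Fract P' Q'"
    and nz: "eval_mpoly \<sigma> Q \<noteq> 0" "eval_mpoly \<sigma> Q' \<noteq> 0"
    and z: "z = eval_mpoly \<sigma> P / eval_mpoly \<sigma> Q" "z' = eval_mpoly \<sigma> P' / eval_mpoly \<sigma> Q'"
    using assms by (auto simp: evaluates_to_def)
  have "Q \<noteq> 0" "Q' \<noteq> 0" using nz by auto
  then show ?thesis
    unfolding evaluates_to_def using nz
    by (intro exI[of _ "P * Q' + P' * Q"] exI[of _ "Q * Q'"])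
      (simp add: r z eval_mpoly_mult eval_mpoly_add add_frac_eq)
qed

lemma evaluates_to_mult:
  assumes "evaluates_to \<sigma> r z" "evaluates_to \<sigma> r' z'"
  shows "evaluates_to \<sigma> (r * r') (z * z')"
proof -
  obtain P Q P' Q' where r: "r = Fract P Q" "r' = Fract P' Q'"
    and nz: "eval_mpoly \<sigma> Q \<noteq> 0" "eval_mpoly \<sigma> Q' \<noteq> 0"
    and z: "z = eval_mpoly \<sigma> P / eval_mpoly \<sigma> Q" "z' = eval_mpoly \<sigma> P' / eval_mpoly \<sigma> Q'"
    using assms by (auto simp: evaluates_to_def)
  then show ?thesis
    unfolding evaluates_to_def
    by (intro exI[of _ "P * P'"] exI[of _ "Q * Q'"]) (simp add: eval_mpoly_mult)
qed

lemma evaluates_to_uminus: "evaluates_to \<sigma> r z \<Longrightarrow> evaluates_to \<sigma> (- r) (- z)"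
proof -
  assume "evaluates_to \<sigma> r z"
  then obtain P Q where r: "r = Fract P Q" "eval_mpoly \<sigma> Q \<noteq> 0" "z = eval_mpoly \<sigma> P / eval_mpoly \<sigma> Q"
    by (auto simp: evaluates_to_def)
  then show ?thesis
    unfolding evaluates_to_def by (intro exI[of _ "- P"] exI[of _ Q]) (simp add: eval_mpoly_uminus)
qed

lemma evaluates_to_diff:
  "evaluates_to \<sigma> r z \<Longrightarrow> evaluates_to \<sigma> r' z' \<Longrightarrow> evaluates_to \<sigma> (r - r') (z - z')"
  using evaluates_to_add[of \<sigma> r z "- r'" "- z'"] evaluates_to_uminus[of \<sigma> r' z'] by simp

lemma evaluates_to_divide:
  assumes "evaluates_to \<sigma> r z" "evaluates_to \<sigma> r' z'" "z' \<noteq> 0"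
  shows "evaluates_to \<sigma> (r / r') (z / z')"
proof -
  obtain P Q where r: "r' = Fract P Q" "eval_mpoly \<sigma> Q \<noteq> 0"
      "z' = eval_mpoly \<sigma> P / eval_mpoly \<sigma> Q"
    using assms(2) by (auto simp: evaluates_to_def)
  have "inverse r' = Fract Q P" "eval_mpoly \<sigma> P \<noteq> 0"
    "inverse z' = eval_mpoly \<sigma> Q / eval_mpoly \<sigma> P"
    using r assms(3) by simp_all
  then have "evaluates_to \<sigma> (inverse r') (inverse z')"
    unfolding evaluates_to_def by blast
  then show ?thesis
    unfolding divide_inverse by (rule evaluates_to_mult[OF assms(1)])
qed

lemma evaluates_to_power: "evaluates_to \<sigma> r z \<Longrightarrow> evaluates_to \<sigma> (r ^ k) (z ^ k)"
  by (induction k) (simp_all add: evaluates_to_1 evaluates_to_mult)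

lemma evaluates_to_sum:
  "(\<And>i. i \<in> I \<Longrightarrow> evaluates_to \<sigma> (r i) (z i)) \<Longrightarrow> evaluates_to \<sigma> (sum r I) (sum z I)"
  by (induction I rule: infinite_finite_induct) (auto simp: evaluates_to_0 evaluates_to_add)

lemma evaluates_to_prod:
  "(\<And>i. i \<in> I \<Longrightarrow> evaluates_to \<sigma> (r i) (z i)) \<Longrightarrow> evaluates_to \<sigma> (prod r I) (prod z I)"
  by (induction I rule: infinite_finite_induct) (auto simp: evaluates_to_1 evaluates_to_mult)

lemma subst_ratfun_eqI:
  assumes "evaluates_to (\<lambda>i. if 1 \<le> i \<and> i \<le> length ys then ys ! (i - 1) else 0) r z"
  shows "subst_ratfun ys r = z"
proof -
  let ?\<sigma> = "\<lambda>i. if 1 \<le> i \<and> i \<le> length ys then ys ! (i - 1) else 0"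
  have "subst_ratfun ys r = (THE z. evaluates_to ?\<sigma> r z)"
    unfolding subst_ratfun_def Let_def evaluates_to_def by (rule refl)
  also have "\<dots> = z"
    using assms by (rule the_equality) (rule evaluates_to_unique[OF _ assms])
  finally show ?thesis .
qed

lemma psi_component_eq_psi_form: "psi_component n d = 1 / 2 * psi_form (\<lambda>t. t ^ (2 * n)) X d"
  unfolding psi_component_def psi_form_def by (simp only: distrib_left)

text \<open>Each denominator is a product of points and differences of points with distinct indices,
  so injectivity including the point 0 makes all of them nonzero.\<close>

lemma evaluates_to_psi_form:
  assumes "\<sigma> 0 = 0" "inj_on \<sigma> {0..d}"
  shows "evaluates_to \<sigma> (psi_form (\<lambda>t. t ^ k) X d) (psi_form (\<lambda>t. t ^ k) \<sigma> d)"
proof -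
  have eq: "\<sigma> i = \<sigma> j \<longleftrightarrow> i = j" if "i \<le> d" "j \<le> d" for i j
    using inj_onD[OF assms(2), of i j] that by auto
  have eq0: "\<sigma> i = 0 \<longleftrightarrow> i = 0" if "i \<le> d" for i
    using eq[of i 0] that assms(1) by simp
  show ?thesis
    unfolding psi_form_def
    by (intro evaluates_to_add evaluates_to_sum evaluates_to_diff evaluates_to_divide
        evaluates_to_power evaluates_to_mult evaluates_to_prod evaluates_to_X assms(1))
      (auto simp: eq eq0)
qed

lemma eval_at_psi:
  assumes "ys \<noteq> []" "distinct ys" "0 \<notin> set ys"
  shows "eval_at (psi n) ys = 1 / 2 * psi_form (\<lambda>t. t ^ (2 * n)) (\<lambda>i. (0 # ys) ! i) (length ys)"
proof -
  define \<sigma> where "\<sigma> = (\<lambda>i. if 1 \<le> i \<and> i \<le> length ys then ys ! (i - 1) else 0)"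
  have \<sigma>: "\<sigma> i = (0 # ys) ! i" if "i \<le> length ys" for i
    using that by (cases i) (auto simp: \<sigma>_def)
  have "\<sigma> 0 = 0" by (simp add: \<sigma>_def)
  moreover have "inj_on \<sigma> {0..length ys}"
    using assms by (intro inj_onI) (auto simp: \<sigma> nth_eq_iff_index_eq[of "0 # ys"])
  ultimately have *: "evaluates_to \<sigma> (psi_form (\<lambda>t. t ^ (2 * n)) X (length ys))
      (psi_form (\<lambda>t. t ^ (2 * n)) \<sigma> (length ys))"
    by (rule evaluates_to_psi_form)
  \<comment> \<open>The division rule needs a nonzero divisor. If 2 were zero in
    \<open>ratfun\<close>, the quotient would be 0 by convention and evaluate to 0.\<close>
  have half: "evaluates_to \<sigma> (1 / 2) (1 / 2)"
  proof (cases "(2 :: ratfun) = 0")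
    case False
    have "evaluates_to \<sigma> (1 + 1) (1 + 1)"
      by (intro evaluates_to_add evaluates_to_1)
    then show ?thesis
      using False by (intro evaluates_to_divide evaluates_to_1) simp_all
  qed (simp add: evaluates_to_0)
  have "eval_at (psi n) ys = 1 / 2 * psi_form (\<lambda>t. t ^ (2 * n)) \<sigma> (length ys)"
    unfolding eval_at_def psi_def
    using assms(1) evaluates_to_mult[OF half *]
    by (intro subst_ratfun_eqI) (simp add: psi_component_eq_psi_form \<sigma>_def Suc_le_eq)
  also have "psi_form (\<lambda>t. t ^ (2 * n)) \<sigma> (length ys) =
      psi_form (\<lambda>t. t ^ (2 * n)) (\<lambda>i. (0 # ys) ! i) (length ys)"
    by (rule psi_form_cong) (rule \<sigma>)
  finally show ?thesis .
qed

subsection \<open>Homogeneity and membership\<close>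

definition monom_degree :: "(nat \<Rightarrow>\<^sub>0 nat) \<Rightarrow> nat" where
  "monom_degree m = (\<Sum>i\<in>Poly_Mapping.keys m. Poly_Mapping.lookup m i)"

lemma monom_degree_add: "monom_degree (m + m') = monom_degree m + monom_degree m'"
proof -
  let ?S = "Poly_Mapping.keys m \<union> Poly_Mapping.keys m'"
  have superset: "monom_degree p = (\<Sum>i\<in>?S. Poly_Mapping.lookup p i)"
    if "Poly_Mapping.keys p \<subseteq> ?S" for p
    unfolding monom_degree_def using that by (intro sum.mono_neutral_left) (auto simp: in_keys_iff)
  show ?thesis
    using superset[of m] superset[of m'] superset[OF keys_add] by (simp add: lookup_add sum.distrib)
qed

lemma monom_degree_single [simp]: "monom_degree (Poly_Mapping.single i k) = k"
  by (cases "k = 0") (simp_all add: monom_degree_def)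

lemma homogeneous_mpoly_iff:
  "homogeneous_mpoly k P \<longleftrightarrow> (\<forall>m\<in>Poly_Mapping.keys P. monom_degree m = k)"
  by (simp add: homogeneous_mpoly_def monom_degree_def)

lemma homogeneous_mpoly_add:
  "homogeneous_mpoly k P \<Longrightarrow> homogeneous_mpoly k Q \<Longrightarrow> homogeneous_mpoly k (P + Q)"
  using keys_add[of P Q] by (auto simp: homogeneous_mpoly_iff)

lemma homogeneous_mpoly_uminus: "homogeneous_mpoly k P \<Longrightarrow> homogeneous_mpoly k (- P)"
  by (simp add: homogeneous_mpoly_iff)

lemma homogeneous_mpoly_mult:
  "homogeneous_mpoly k P \<Longrightarrow> homogeneous_mpoly l Q \<Longrightarrow> homogeneous_mpoly (k + l) (P * Q)"
  using keys_mult[of P Q] by (fastforce simp: homogeneous_mpoly_iff monom_degree_add)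

lemma homogeneous_mpoly_single: "homogeneous_mpoly (monom_degree m) (Poly_Mapping.single m c)"
  by (simp add: homogeneous_mpoly_iff)

lemma homogeneous_mpoly_1: "homogeneous_mpoly 0 1"
  using homogeneous_mpoly_single[of 0 1] by (simp add: monom_degree_def)

lemma homogeneous_ratfunI:
  "homogeneous_mpoly a P \<Longrightarrow> homogeneous_mpoly b Q \<Longrightarrow> Q \<noteq> 0 \<Longrightarrow>
     homogeneous_ratfun (int a - int b) (Fract P Q)"
  unfolding homogeneous_ratfun_def by blast

lemma homogeneous_ratfunE:
  assumes "homogeneous_ratfun k r"
  obtains P Q a b where "homogeneous_mpoly a P" "homogeneous_mpoly b Q" "Q \<noteq> 0"
    "r = Fract P Q" "k = int a - int b"
  using assms unfolding homogeneous_ratfun_def by blast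

text \<open>The zero polynomial is homogeneous of every degree; for negative \<open>k\<close> a
  power of an indeterminate in the denominator supplies the missing degree.\<close>

lemma homogeneous_ratfun_0: "homogeneous_ratfun k 0"
proof -
  define Q :: mpoly where "Q = Poly_Mapping.single (Poly_Mapping.single 0 (nat (- k))) 1"
  have "Q \<noteq> 0" by (simp add: Q_def flip: keys_eq_empty)
  moreover have "homogeneous_mpoly (nat (- k)) Q"
    using homogeneous_mpoly_single[of "Poly_Mapping.single 0 (nat (- k))" 1]
    by (simp add: Q_def)
  moreover have "homogeneous_mpoly (nat k) 0"
    by (simp add: homogeneous_mpoly_iff)
  ultimately have "homogeneous_ratfun (int (nat k) - int (nat (- k))) (Fract 0 Q)"
    by (intro homogeneous_ratfunI)
  moreover have "int (nat k) - int (nat (- k)) = k" by simp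
  ultimately show ?thesis by (simp only: fract_collapse)
qed

lemma homogeneous_ratfun_ratconst: "homogeneous_ratfun 0 (ratconst c)"
  using homogeneous_ratfunI[OF homogeneous_mpoly_single[of 0 c] homogeneous_mpoly_1]
  by (simp add: ratconst_def monom_degree_def)

lemma homogeneous_ratfun_X: "homogeneous_ratfun 1 (X i)"
  using homogeneous_ratfunI[OF homogeneous_mpoly_single[of "Poly_Mapping.single i 1" 1] homogeneous_mpoly_1]
  by (simp add: X_def homogeneous_ratfun_0)

lemma homogeneous_ratfun_add:
  assumes "homogeneous_ratfun k r" "homogeneous_ratfun k s"
  shows "homogeneous_ratfun k (r + s)"
proof -
  obtain P Q a b where 1: "homogeneous_mpoly a P" "homogeneous_mpoly b Q" "Q \<noteq> 0"
    "r = Fract P Q" "k = int a - int b" using assms(1) by (rule homogeneous_ratfunE)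
  obtain P' Q' a' b' where 2: "homogeneous_mpoly a' P'" "homogeneous_mpoly b' Q'" "Q' \<noteq> 0"
    "s = Fract P' Q'" "k = int a' - int b'" using assms(2) by (rule homogeneous_ratfunE)
  have deg: "a' + b = a + b'" using 1(5) 2(5) by linarith
  have "homogeneous_mpoly (a + b') (P * Q' + P' * Q)"
    using homogeneous_mpoly_mult[OF 1(1) 2(2)] homogeneous_mpoly_mult[OF 2(1) 1(2)]
    unfolding deg by (rule homogeneous_mpoly_add)
  then have "homogeneous_ratfun (int (a + b') - int (b + b')) (Fract (P * Q' + P' * Q) (Q * Q'))"
    using 1(3) 2(3) by (intro homogeneous_ratfunI homogeneous_mpoly_mult 1(2) 2(2)) simp_all
  moreover have "int (a + b') - int (b + b') = k" using 1(5) by simp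
  ultimately show ?thesis using 1 2 by (simp add: add_fract)
qed

lemma homogeneous_ratfun_uminus: "homogeneous_ratfun k r \<Longrightarrow> homogeneous_ratfun k (- r)"
  by (erule homogeneous_ratfunE) (simp add: homogeneous_ratfunI homogeneous_mpoly_uminus)

lemma homogeneous_ratfun_diff:
  "homogeneous_ratfun k r \<Longrightarrow> homogeneous_ratfun k s \<Longrightarrow> homogeneous_ratfun k (r - s)"
  unfolding diff_conv_add_uminus by (intro homogeneous_ratfun_add homogeneous_ratfun_uminus)

lemma homogeneous_ratfun_mult:
  assumes "homogeneous_ratfun k r" "homogeneous_ratfun l s"
  shows "homogeneous_ratfun (k + l) (r * s)"
proof -
  obtain P Q a b where 1: "homogeneous_mpoly a P" "homogeneous_mpoly b Q" "Q \<noteq> 0"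
    "r = Fract P Q" "k = int a - int b" using assms(1) by (rule homogeneous_ratfunE)
  obtain P' Q' a' b' where 2: "homogeneous_mpoly a' P'" "homogeneous_mpoly b' Q'" "Q' \<noteq> 0"
    "s = Fract P' Q'" "l = int a' - int b'" using assms(2) by (rule homogeneous_ratfunE)
  have "homogeneous_ratfun (int (a + a') - int (b + b')) (Fract (P * P') (Q * Q'))"
    using 1(3) 2(3) by (intro homogeneous_ratfunI homogeneous_mpoly_mult 1 2) simp
  moreover have "int (a + a') - int (b + b') = k + l" using 1(5) 2(5) by simp
  ultimately show ?thesis unfolding 1(4) 2(4) mult_fract by (simp only:)
qed

text \<open>Division by zero yields zero, which is homogeneous of every degree, so no condition on
  the divisor is required.\<close>

lemma homogeneous_ratfun_divide:
  assumes "homogeneous_ratfun k r" "homogeneous_ratfun l s"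
  shows "homogeneous_ratfun (k - l) (r / s)"
proof (cases "s = 0")
  case False
  obtain P Q a b where s: "homogeneous_mpoly a P" "homogeneous_mpoly b Q" "Q \<noteq> 0"
    "s = Fract P Q" "l = int a - int b" using assms(2) by (rule homogeneous_ratfunE)
  then have "P \<noteq> 0" using False by (auto simp: fract_collapse)
  then have "homogeneous_ratfun (int b - int a) (inverse s)"
    using s by (simp add: homogeneous_ratfunI)
  moreover have "k + (int b - int a) = k - l" using s(5) by simp
  ultimately show ?thesis
    using homogeneous_ratfun_mult[OF assms(1), of "int b - int a" "inverse s"]
    unfolding divide_inverse by (simp only:)
qed (simp add: homogeneous_ratfun_0)

lemma homogeneous_ratfun_power:
  "homogeneous_ratfun 1 r \<Longrightarrow> homogeneous_ratfun (int k) (r ^ k)"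
proof (induction k)
  case 0
  show ?case using homogeneous_ratfun_ratconst[of 1] by simp
next
  case (Suc k)
  then show ?case using homogeneous_ratfun_mult[of 1 r "int k"] by (simp add: add.commute)
qed

lemma homogeneous_ratfun_prod:
  "(\<And>i. i \<in> I \<Longrightarrow> homogeneous_ratfun 1 (r i)) \<Longrightarrow> homogeneous_ratfun (int (card I)) (prod r I)"
proof (induction I rule: infinite_finite_induct)
  case (insert i I)
  then show ?case using homogeneous_ratfun_mult[of 1 "r i" "int (card I)"] by simp
qed (use homogeneous_ratfun_ratconst[of 1] in simp_all)

lemma homogeneous_ratfun_sum:
  "(\<And>i. i \<in> I \<Longrightarrow> homogeneous_ratfun k (r i)) \<Longrightarrow> homogeneous_ratfun k (sum r I)"
  by (induction I rule: infinite_finite_induct) (simp_all add: homogeneous_ratfun_0 homogeneous_ratfun_add)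

text \<open>Lets the structural rules compute the degree as a schematic variable and leaves the
  comparison of degrees to arithmetic.\<close>

lemma homogeneous_ratfun_degree_eq: "homogeneous_ratfun k r \<Longrightarrow> k = l \<Longrightarrow> homogeneous_ratfun l r"
  by simp

lemma half_eq_ratconst: "1 / 2 = ratconst (1 / 2)"
proof -
  have "ratconst (1 / 2) + ratconst (1 / 2) = 1"
    unfolding ratconst_simps(3)[symmetric] by simp
  then have "2 * ratconst (1 / 2) = 1" by (simp only: mult_2)
  moreover from this have "(2 :: ratfun) \<noteq> 0" by auto
  ultimately show ?thesis by (simp add: field_simps)
qed

text \<open>Every summand is a linear form to the power \<open>2 * n\<close>, divided by
  \<open>d - 1\<close> linear forms.\<close>

lemma homogeneous_ratfun_psi_component:
  assumes "d \<ge> 1"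
  shows "homogeneous_ratfun (2 * int n + 1 - int d) (psi_component n d)"
proof -
  note intros = homogeneous_ratfun_diff homogeneous_ratfun_divide homogeneous_ratfun_power
    homogeneous_ratfun_prod homogeneous_ratfun_mult homogeneous_ratfun_X
  have "homogeneous_ratfun (2 * int n + 1 - int d)
      ((X i - X (i - 1)) ^ (2 * n) /
        ((\<Prod>a\<in>{0..<i - 1}. X a - X (i - 1)) * (\<Prod>b\<in>{i + 1..d}. X b - X i)))"
    if "i \<in> {1..d}" for i
    \<comment> \<open>The restriction \<open>[1]\<close> confines the structural rules to the
      homogeneity goal, so that only the equation between degrees is left.\<close>
    by (rule homogeneous_ratfun_degree_eq, ((rule intros)+)[1], use that in \<open>simp add: of_nat_diff\<close>)
  moreover have "homogeneous_ratfun (2 * int n + 1 - int d)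
      (X d ^ (2 * n) / ((\<Prod>a\<in>{1..<i}. X a) * (\<Prod>b\<in>{i..<d}. X b - X d)))"
    if "i \<in> {1..d}" for i
    by (rule homogeneous_ratfun_degree_eq, ((rule intros)+)[1], use that in \<open>simp add: of_nat_diff\<close>)
  moreover have "homogeneous_ratfun (2 * int n + 1 - int d)
      ((X 1 - X d) ^ (2 * n) /
        (X d * (\<Prod>a\<in>{2..i}. X a - X 1) * (\<Prod>b\<in>{i + 1..<d}. X b - X d)))"
    if "i \<in> {1..<d}" for i
    by (rule homogeneous_ratfun_degree_eq, ((rule intros)+)[1], use that in \<open>simp add: of_nat_diff\<close>)
  moreover have "homogeneous_ratfun (2 * int n + 1 - int d)
      (X (d - 1) ^ (2 * n) /
        (X d * (\<Prod>a\<in>{1..<i}. X a) * (\<Prod>b\<in>{i..<d - 1}. X b - X (d - 1))))"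
    if "i \<in> {1..<d}" for i
    by (rule homogeneous_ratfun_degree_eq, ((rule intros)+)[1], use that in \<open>simp add: of_nat_diff\<close>)
  ultimately have "homogeneous_ratfun (2 * int n + 1 - int d) (psi_form (\<lambda>t. t ^ (2 * n)) X d)"
    unfolding psi_form_def
    by (intro homogeneous_ratfun_add homogeneous_ratfun_diff homogeneous_ratfun_sum)
  from homogeneous_ratfun_mult[OF homogeneous_ratfun_ratconst this] show ?thesis
    by (simp add: psi_component_eq_psi_form half_eq_ratconst)
qed

section \<open>Membership in the rings \<open>ringO d\<close>\<close>

lemma ringO_0: "0 \<in> ringO d" and ringO_1: "1 \<in> ringO d" and ringO_uminus_1: "- 1 \<in> ringO d"
  using ringO.const[of 0 d] ringO.const[of 1 d] ringO.const[of "- 1" d]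
    ratconst_simps(3)[of 1 "- 1"] by (simp_all add: eq_neg_iff_add_eq_0[symmetric] add.commute minus_equation_iff)

lemma ringO_uminus: "r \<in> ringO d \<Longrightarrow> - r \<in> ringO d"
  using ringO.mult[OF ringO_uminus_1] by fastforce

lemma ringO_diff: "r \<in> ringO d \<Longrightarrow> s \<in> ringO d \<Longrightarrow> r - s \<in> ringO d"
  unfolding diff_conv_add_uminus by (intro ringO.add ringO_uminus)

lemma ringO_power: "r \<in> ringO d \<Longrightarrow> r ^ k \<in> ringO d"
  by (induction k) (simp_all add: ringO_1 ringO.mult)

lemma ringO_sum: "(\<And>i. i \<in> I \<Longrightarrow> r i \<in> ringO d) \<Longrightarrow> sum r I \<in> ringO d"
  by (induction I rule: infinite_finite_induct) (simp_all add: ringO_0 ringO.add)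

lemma ringO_X: "i \<le> d \<Longrightarrow> X i \<in> ringO d"
  by (cases "i = 0") (auto simp: X_def[of 0] ringO_0 intro: ringO.var)

lemma ringO_divide: "r \<in> ringO d \<Longrightarrow> inverse s \<in> ringO d \<Longrightarrow> r / s \<in> ringO d"
  unfolding divide_inverse by (rule ringO.mult)

lemma ringO_inverse_mult:
  "inverse r \<in> ringO d \<Longrightarrow> inverse s \<in> ringO d \<Longrightarrow> inverse (r * s) \<in> ringO d"
  unfolding inverse_mult_distrib by (rule ringO.mult)

lemma ringO_inverse_prod:
  "(\<And>i. i \<in> I \<Longrightarrow> inverse (r i) \<in> ringO d) \<Longrightarrow> inverse (prod r I) \<in> ringO d"
  by (induction I rule: infinite_finite_induct) (simp_all add: ringO_1 ringO.mult)

text \<open>The generators cover only \<open>1 \<le> i < j\<close>; the reversed order costs a sign,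
  and index 0 reduces to the inverse of a variable.\<close>

lemma ringO_inverse_diff:
  assumes "i \<noteq> j" "i \<le> d" "j \<le> d"
  shows "inverse (X i - X j) \<in> ringO d"
proof -
  have less: "inverse (X i - X j) \<in> ringO d" if "i < j" "j \<le> d" for i j
  proof (cases "i = 0")
    case True
    have "inverse (X j) \<in> ringO d" using that by (intro ringO.inverse_var) auto
    then show ?thesis
      using ringO_uminus True by (fastforce simp: X_def[of 0] inverse_minus_eq)
  qed (use that in \<open>auto intro: ringO.inverse_diff\<close>)
  have "inverse (X i - X j) = - inverse (X j - X i)"
    by (metis inverse_minus_eq minus_diff_eq)
  then show ?thesis
    using less[of i j] ringO_uminus[OF less[of j i]] assms by (cases "i < j") auto
qed

lemma psi_component_in_ringO: "psi_component n d \<in> ringO d"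
  unfolding psi_component_eq_psi_form half_eq_ratconst psi_form_def
  by (intro ringO.add ringO.mult ringO_sum ringO_diff ringO_divide ringO_inverse_mult
      ringO_inverse_prod ringO_power ringO_inverse_diff ringO_X ringO.inverse_var ringO.const) auto

lemma psi_in_prodO: "psi n \<in> \<O>"
  by (auto simp: prodO_def psi_def psi_component_in_ringO)

lemma homogeneous_of_weight_psi: "homogeneous_of_weight (2 * int n + 1) (psi n)"
  using homogeneous_ratfun_psi_component
  by (simp add: homogeneous_of_weight_def psi_in_prodO) (simp add: psi_def)

subsection \<open>The double shuffle equations\<close>

lemma X_0 [simp]: "X 0 = 0"
  by (simp add: X_def)

lemma single_eq_single_iff:
  "c \<noteq> 0 \<Longrightarrow> Poly_Mapping.single i c = Poly_Mapping.single j c \<longleftrightarrow> i = j"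
  by (metis keys_single singleton_inject)

text \<open>A sum of distinct variables has coefficient 1 at each of them.\<close>

lemma subset_sums_nonzero_X: "subset_sums_nonzero (X ` {1..})"
  unfolding subset_sums_nonzero_def
proof (intro allI impI)
  fix F assume "F \<subseteq> X ` {1..}" "finite F \<and> F \<noteq> {}"
  \<comment> \<open>Choosing one index for each element of \<open>F\<close> makes \<open>X\<close>
    injective on \<open>I\<close>; global injectivity is derived from this lemma only
    afterwards.\<close>
  then obtain I where I: "I \<subseteq> {1..}" "F = X ` I" "inj_on X I"
    by (auto simp: subset_image_inj)
  with \<open>finite F \<and> F \<noteq> {}\<close> have fin: "finite I" "I \<noteq> {}"
    by (auto dest: finite_imageD)
  let ?m = "\<lambda>i. Poly_Mapping.single i 1 :: nat \<Rightarrow>\<^sub>0 nat"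
  have "sum X J = Fract (\<Sum>i\<in>J. Poly_Mapping.single (?m i) 1) 1" if "finite J" "J \<subseteq> {1..}" for J
    using that by (induction J rule: finite_induct) (auto simp: fract_collapse X_def)
  moreover obtain j where j: "j \<in> I" using fin by blast
  have "Poly_Mapping.lookup (\<Sum>i\<in>I. Poly_Mapping.single (?m i) (1 :: rat)) (?m j) =
      (\<Sum>i\<in>I. if i = j then 1 else 0)"
    unfolding lookup_sum
    by (intro sum.cong refl) (auto simp: lookup_single when_def single_eq_single_iff)
  then have "(\<Sum>i\<in>I. Poly_Mapping.single (?m i) (1 :: rat)) \<noteq> 0"
    using fin j by auto
  ultimately have "sum X I \<noteq> 0"
    using fin I by (simp add: Zero_fract_def eq_fract)
  then show "\<Sum>F \<noteq> 0"
    using I by (simp add: sum.reindex)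
qed

lemma X_eq_iff: "X i = X j \<longleftrightarrow> i = j"
proof -
  have "X i \<noteq> 0" if "i \<noteq> 0" for i
    using subset_sums_nonzero_X[unfolded subset_sums_nonzero_def, rule_format, of "{X i}"] that by auto
  then show ?thesis
    by (cases "i = 0"; cases "j = 0")
      (auto simp: X_def eq_fract single_eq_single_iff split: if_splits)
qed

lemma word_in_map_X:
  assumes "distinct w" "0 \<notin> set w"
  shows "word_in (X ` {1..}) (map X w)"
proof -
  have "1 \<le> i" if "i \<in> set w" for i
    using that assms(2) by (metis less_one not_le)
  then have "X ` set w \<subseteq> X ` {1..}" by (intro image_mono) auto
  then show ?thesis
    using assms(1) by (simp add: word_in_def distinct_map inj_on_def X_eq_iff)
qed

lemma zero_notin_X: "0 \<notin> X ` {1..}"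
proof
  assume "0 \<in> X ` {1..}"
  then obtain i where "1 \<le> i" "X i = X 0" by auto
  then show False by (simp only: X_eq_iff)
qed

text \<open>The prefix \<open>u\<close> accumulated by \<open>stuffle_sum\<close> is absorbed into
  the functional. The empty word is excluded because a family in \<open>\<O>\<close> has no
  component of depth 0.\<close>

lemma stuffle_sum_eq_qsh:
  assumes "distinct (u @ v @ w)" "u @ v @ w \<noteq> []"
    and "\<And>r. distinct (u @ r) \<Longrightarrow> set r \<subseteq> set v \<union> set w \<Longrightarrow> u @ r \<noteq> [] \<Longrightarrow>
      eval_at f (map X (u @ r)) = \<phi> (map X r)"
  shows "stuffle_sum f u v w = qsh stuffle_coeff \<phi> (map X v) (map X w)"
  using assms
proof (induction f u v w arbitrary: \<phi> rule: stuffle_sum.induct)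
  case (2 f u a v)
  then show ?case using 2(3)[of "a # v"] by auto
next
  case (3 f u a v b w)
  have extend: "eval_at f (map X ((u @ [c]) @ r)) = \<phi> (X c # map X r)"
    if "c \<in> {a, b}" "distinct ((u @ [c]) @ r)" "set r \<subseteq> set (a # v) \<union> set (b # w)" for c r
    using 3(7)[of "c # r"] that by auto
  have "stuffle_sum f (u @ [a]) v (b # w) =
      qsh stuffle_coeff (\<lambda>r. \<phi> (X a # r)) (map X v) (map X (b # w))"
    by (rule 3(1); (rule extend)?; use 3(5) in auto)
  moreover have "stuffle_sum f (u @ [b]) (a # v) w =
      qsh stuffle_coeff (\<lambda>r. \<phi> (X b # r)) (map X (a # v)) (map X w)"
    by (rule 3(2); (rule extend)?; use 3(5) in auto)
  moreover have "stuffle_sum f (u @ [a]) v w =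
      qsh stuffle_coeff (\<lambda>r. \<phi> (X a # r)) (map X v) (map X w)"
    by (rule 3(3); (rule extend)?; use 3(5) in auto)
  moreover have "stuffle_sum f (u @ [b]) v w =
      qsh stuffle_coeff (\<lambda>r. \<phi> (X b # r)) (map X v) (map X w)"
    by (rule 3(4); (rule extend)?; use 3(5) in auto)
  ultimately show ?case
    by (simp add: divide_inverse mult.commute)
qed auto

lemma stuffle_equations_psi: "stuffle_equations (psi n)"
  unfolding stuffle_equations_def
proof (intro allI impI)
  fix p q :: nat assume pq: "p \<ge> 1" "q \<ge> 1"
  define v w where "v = [1..<p + 1]" and "w = [p + 1..<p + q + 1]"
  let ?S = "X ` (set v \<union> set w)" and ?g = "\<lambda>t :: ratfun. t ^ (2 * n)"
  have vw: "v \<noteq> []" "w \<noteq> []" "distinct (v @ w)" "0 \<notin> set (v @ w)"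
    using pq by (auto simp: v_def w_def)
  have "stuffle_sum (psi n) [] v w =
      qsh stuffle_coeff (\<lambda>u. 1 / 2 * stuffle_generator ?g ?S u) (map X v) (map X w)"
  proof (rule stuffle_sum_eq_qsh)
    fix r assume r: "distinct ([] @ r)" "set r \<subseteq> set v \<union> set w" "[] @ r \<noteq> []"
    have "0 \<notin> set r" using r(2) vw(4) by auto
    then have "word_in (X ` {1..}) (map X r)" using r(1) by (intro word_in_map_X) simp_all
    then have "distinct (map X r)" "0 \<notin> set (map X r)"
      using zero_notin_X unfolding word_in_def by blast+
    then have "eval_at (psi n) (map X r) =
        1 / 2 * psi_form ?g (\<lambda>i. (0 # map X r) ! i) (length (map X r))"
      using r(3) by (intro eval_at_psi) simp_all
    also have "psi_form ?g (\<lambda>i. (0 # map X r) ! i) (length (map X r)) =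
        stuffle_generator ?g ?S (map X r)"
      by (rule psi_form_eq_stuffle_generator) (use r in auto)
    finally show "eval_at (psi n) (map X ([] @ r)) = 1 / 2 * stuffle_generator ?g ?S (map X r)"
      by simp
  qed (use vw in auto)
  also have "\<dots> = 0"
  proof (rule infinitesimal_vanishes)
    show "infinitesimal stuffle_coeff (X ` {1..}) (\<lambda>u. 1 / 2 * stuffle_generator ?g ?S u)"
      by (intro infinitesimal_scale infinitesimal_stuffle_generator zero_notin_X)
    show "word_in (X ` {1..}) (map X v @ map X w)"
      using word_in_map_X[OF vw(3,4)] by simp
  qed (use vw in simp_all)
  finally show "stuffle_sum (psi n) [] [1..<p + 1] [p + 1..<p + q + 1] = 0"
    by (simp only: v_def w_def)
qed

text \<open>Disjointness makes the shuffles starting with \<open>a\<close> and those starting with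
  \<open>b\<close> disjoint sets, so the sum over the set counts each shuffle once, as
  \<open>qsh\<close> does.\<close>

lemma sum_shuffles_eq_qsh:
  assumes "set v \<inter> set w = {}"
  shows "(\<Sum>u\<in>shuffles v w. \<phi> (map f u)) = qsh shuffle_coeff \<phi> (map f v) (map f w)"
  using assms
proof (induction v w arbitrary: \<phi> rule: word_pair_induct)
  case (Cons a v b w)
  have "(\<Sum>u\<in>shuffles (a # v) (b # w). \<phi> (map f u)) =
      (\<Sum>u\<in>(#) a ` shuffles v (b # w). \<phi> (map f u)) +
      (\<Sum>u\<in>(#) b ` shuffles (a # v) w. \<phi> (map f u))"
    unfolding shuffles.simps using Cons.prems by (intro sum.union_disjoint) auto
  also have "\<dots> = (\<Sum>u\<in>shuffles v (b # w). \<phi> (f a # map f u)) +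
      (\<Sum>u\<in>shuffles (a # v) w. \<phi> (f b # map f u))"
    by (simp add: sum.reindex)
  also have "\<dots> = qsh shuffle_coeff \<phi> (map f (a # v)) (map f (b # w))"
    using Cons.prems Cons.IH(1)[of "\<lambda>u. \<phi> (f a # u)"] Cons.IH(2)[of "\<lambda>u. \<phi> (f b # u)"] by simp
  finally show ?case .
qed simp_all

text \<open>Two prefix sums differ by the sum of a nonempty factor of the word.\<close>

lemma prefix_sums_inj:
  assumes "subset_sums_nonzero V" "word_in V y"
  shows "inj_on (\<lambda>i. sum_list (take i y) :: 'a::ab_group_add) {0..length y}"
proof (rule linorder_inj_onI)
  fix i j assume ij: "i < j" "i \<in> {0..length y}" "j \<in> {0..length y}"
  have "slice y i j = drop i (take j y)"
    using ij by (simp add: take_conv_slice drop_slice)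
  then have "word_in V (slice y i j)"
    using assms(2) by (simp add: word_in_take word_in_drop)
  then have "sum_list (slice y i j) \<noteq> 0"
    using ij by (intro sum_list_neq_0[OF assms(1)]) simp_all
  then show "sum_list (take i y) \<noteq> sum_list (take j y)"
    using ij by (simp add: sum_list_slice)
qed auto

lemma eval_at_psi_prefix_sums:
  assumes u: "distinct u" "0 \<notin> set u" "u \<noteq> []"
  shows "eval_at (psi n) (map (\<lambda>k. \<Sum>j<k. X (u ! j)) [1..<length u + 1]) =
    1 / 2 * shuffle_generator (\<lambda>t. t ^ (2 * n)) (sum_list (map X u)) (map X u)"
proof -
  let ?y = "map X u" and ?g = "\<lambda>t :: ratfun. t ^ (2 * n)"
  let ?ys = "map (\<lambda>k. \<Sum>j<k. X (u ! j)) [1..<length u + 1]"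
  have sum: "(\<Sum>j<k. X (u ! j)) = sum_list (take k ?y)" if "k \<le> length u" for k
    using that by (simp add: sum_list_sum_nth lessThan_atLeast0)
  have nth: "(0 # ?ys) ! i = sum_list (take i ?y)" if "i \<le> length u" for i
    using that by (cases i) (simp_all add: sum take_Suc_conv_app_nth del: upt_Suc)
  have inj: "inj_on (\<lambda>i. sum_list (take i ?y)) {0..length ?y}"
    by (rule prefix_sums_inj[OF subset_sums_nonzero_X word_in_map_X]) (use u in simp_all)
  have "distinct (0 # ?ys)"
    unfolding distinct_conv_nth
  proof (intro allI impI)
    fix i j assume "i < length (0 # ?ys)" "j < length (0 # ?ys)" "i \<noteq> j"
    then have ij: "i \<le> length u" "j \<le> length u" "i \<noteq> j" by (auto simp del: upt_Suc)
    then show "(0 # ?ys) ! i \<noteq> (0 # ?ys) ! j"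
      unfolding nth[OF ij(1)] nth[OF ij(2)] using inj_onD[OF inj, of i j] by auto
  qed
  then have "eval_at (psi n) ?ys = 1 / 2 * psi_form ?g (\<lambda>i. (0 # ?ys) ! i) (length ?ys)"
    using u(3) by (intro eval_at_psi) (auto simp: Suc_le_eq)
  also have "psi_form ?g (\<lambda>i. (0 # ?ys) ! i) (length ?ys) =
      psi_form ?g (\<lambda>i. sum_list (take i ?y)) (length ?y)"
    using psi_form_cong[OF nth, where g = ?g and d = "length u"] by (simp del: upt_Suc)
  also have "\<dots> = shuffle_generator ?g (sum_list ?y) ?y"
    using u(3) by (intro psi_form_eq_shuffle_generator) simp_all
  finally show ?thesis .
qed

lemma shuffle_equations_psi: "shuffle_equations (psi n)"
  unfolding shuffle_equations_def
proof (intro allI impI)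
  fix p q :: nat assume pq: "p \<ge> 1" "q \<ge> 1"
  define v w where "v = [1..<p + 1]" and "w = [p + 1..<p + q + 1]"
  \<comment> \<open>The common total of all shuffles of \<open>v\<close> and \<open>w\<close>: with
    this one value of \<open>t\<close>, the same infinitesimal character describes every
    summand.\<close>
  define t where "t = sum X (set v \<union> set w)"
  let ?g = "\<lambda>t :: ratfun. t ^ (2 * n)"
  have vw: "v \<noteq> []" "w \<noteq> []" "distinct (v @ w)" "0 \<notin> set (v @ w)" "length v + length w = p + q"
    using pq by (auto simp: v_def w_def)
  have "(\<Sum>u\<in>shuffles v w. eval_at (psi n) (map (\<lambda>k. \<Sum>j<k. X (u ! j)) [1..<p + q + 1])) =
      (\<Sum>u\<in>shuffles v w. 1 / 2 * shuffle_generator ?g t (map X u))"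
  proof (intro sum.cong refl)
    fix u assume u: "u \<in> shuffles v w"
    have "distinct u" "set u = set v \<union> set w" "length u = p + q"
      using u vw by (auto simp: set_shuffles length_shuffles intro: distinct_disjoint_shuffles)
    moreover from this have "sum_list (map X u) = t"
      by (simp add: sum_list_distinct_conv_sum_set t_def)
    ultimately show "eval_at (psi n) (map (\<lambda>k. \<Sum>j<k. X (u ! j)) [1..<p + q + 1]) =
        1 / 2 * shuffle_generator ?g t (map X u)"
      using eval_at_psi_prefix_sums[of u n] vw by fastforce
  qed
  also have "\<dots> = qsh shuffle_coeff (\<lambda>u. 1 / 2 * shuffle_generator ?g t u) (map X v) (map X w)"
    by (rule sum_shuffles_eq_qsh) (use vw(3) in simp)
  also have "\<dots> = 0"
  proof (rule infinitesimal_vanishes)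
    show "infinitesimal shuffle_coeff (X ` {1..}) (\<lambda>u. 1 / 2 * shuffle_generator ?g t u)"
      by (intro infinitesimal_scale infinitesimal_shuffle_generator subset_sums_nonzero_X)
    show "word_in (X ` {1..}) (map X v @ map X w)"
      using word_in_map_X[OF vw(3,4)] by simp
  qed (use vw in simp_all)
  finally show "(\<Sum>w\<in>shuffles [1..<p + 1] [p + 1..<p + q + 1].
      eval_at (psi n) (map (\<lambda>k. \<Sum>j<k. X (w ! j)) [1..<p + q + 1])) = 0"
    by (simp only: v_def w_def)
qed

theorem theorem1p1:
  fixes n :: nat
  assumes "n \<ge> 1"
  shows "homogeneous_of_weight (2 * int n + 1) (psi n) \<and> psi n \<in> pdmr"
  by (simp add: homogeneous_of_weight_psi pdmr_def psi_in_prodO shuffle_equations_psi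
      stuffle_equations_psi)

end
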